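(* Let $\pi$ be a set of primes and let $G$ be a finite $\pi$-solvable group. Then the degree $\chi(1)$ of every $\mathcal{P}_\pi$-character $\chi$ of $G$ is a $\pi$-number if and only if $G$ has a normal $\pi$-complement.
   Context: All groups are finite and all characters are complex characters. $\operatorname{Irr}(G)$ is the set of irreducible characters of $G$. For a set $\pi$ of primes, $\pi'$ is the complementary set of primes; a positive integer is a $\pi$-number if all of its prime divisors lie in $\pi$ (so $1$ is a $\pi$-number), and a $\pi$-group ($\pi'$-group) is a finite group whose order is a $\pi$-number ($\pi'$-number). A finite group is $\pi$-solvable if each of its chief factors is either a $\pi'$-group or an elementary abelian $p$-group for some $p\in\pi$. A normal $\pi$-complement of $G$ is a normal Hall $\pi'$-subgroup of $G$, i.e. a normal subgroup $H$ such that $|H|$ is a $\pi'$-number and $|G:H|$ is a $\pi$-number. For a subgroup $M\le G$, $1_M$ is the principal (trivial) character of $M$ and $(1_M)^G$ is the character of $G$ induced from it. A character $\chi\in\operatorname{Irr}(G)$ is a $\mathcal{P}_\pi$-character of $G$ if $[\chi,(1_M)^G]\neq 0$ for some maximal subgroup $M$ of $G$ such that $|G:M|$ is a $\pi$-number, where $[\cdot,\cdot]$ is the usual inner product of class functions. *)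

theory Defs
  imports
    "HOL-Computational_Algebra.Primes"
    "HOL-Algebra.Coset"
    "Jordan_Normal_Form.VS_Connect"
begin

definition pi_number :: "nat set \<Rightarrow> nat \<Rightarrow> bool" where
  "pi_number \<pi> n \<longleftrightarrow> n > 0 \<and> (\<forall>p. prime p \<and> p dvd n \<longrightarrow> p \<in> \<pi>)"

definition prime_complement :: "nat set \<Rightarrow> nat set" where
  "prime_complement \<pi> = {p. prime p \<and> p \<notin> \<pi>}"

definition pi_group :: "nat set \<Rightarrow> ('a, 'b) monoid_scheme \<Rightarrow> bool" where
  "pi_group \<pi> G \<longleftrightarrow> group G \<and> finite (carrier G) \<and> pi_number \<pi> (Coset.order G)"

definition elementary_abelian :: "nat \<Rightarrow> ('a, 'b) monoid_scheme \<Rightarrow> bool" where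
  "elementary_abelian p G \<longleftrightarrow>
     prime p \<and> comm_group G \<and> finite (carrier G) \<and>
     (\<forall>x\<in>carrier G. x [^]\<^bsub>G\<^esub> p = \<one>\<^bsub>G\<^esub>)"

text \<open>\<open>chief_pair G K L\<close> says that \<open>K / L\<close> is a chief factor of \<open>G\<close>.\<close>

definition chief_pair :: "('a, 'b) monoid_scheme \<Rightarrow> 'a set \<Rightarrow> 'a set \<Rightarrow> bool" where
  "chief_pair G K L \<longleftrightarrow>
     K \<lhd> G \<and> L \<lhd> G \<and> L \<subset> K \<and> \<not> (\<exists>N. N \<lhd> G \<and> L \<subset> N \<and> N \<subset> K)"

definition pi_solvable :: "nat set \<Rightarrow> ('a, 'b) monoid_scheme \<Rightarrow> bool" where
  "pi_solvable \<pi> G \<longleftrightarrow>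
     (\<forall>K L. chief_pair G K L \<longrightarrow>
        pi_group (prime_complement \<pi>) (G\<lparr>carrier := K\<rparr> Mod L) \<or>
        (\<exists>p\<in>\<pi>. elementary_abelian p (G\<lparr>carrier := K\<rparr> Mod L)))"

definition maximal_subgroup :: "'a set \<Rightarrow> ('a, 'b) monoid_scheme \<Rightarrow> bool" where
  "maximal_subgroup M G \<longleftrightarrow>
     subgroup M G \<and> M \<noteq> carrier G \<and>
     (\<forall>H. subgroup H G \<and> M \<subseteq> H \<longrightarrow> H = M \<or> H = carrier G)"

definition group_index :: "('a, 'b) monoid_scheme \<Rightarrow> 'a set \<Rightarrow> nat" where
  "group_index G H = card (rcosets\<^bsub>G\<^esub> H)"

definition normal_pi_complement :: "nat set \<Rightarrow> 'a set \<Rightarrow> ('a, 'b) monoid_scheme \<Rightarrow> bool" where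
  "normal_pi_complement \<pi> H G \<longleftrightarrow>
     H \<lhd> G \<and> pi_number (prime_complement \<pi>) (card H) \<and> pi_number \<pi> (group_index G H)"

text \<open>The codomain of a matrix representation is the group of units of the full matrix ring,
  that is, the general linear group of degree \<open>n\<close>.\<close>

definition representation :: "('a, 'b) monoid_scheme \<Rightarrow> nat \<Rightarrow> ('a \<Rightarrow> complex mat) \<Rightarrow> bool" where
  "representation G n \<rho> \<longleftrightarrow> \<rho> \<in> hom G (units_of (ring_mat TYPE(complex) n ()))"

definition irreducible_representation ::
    "('a, 'b) monoid_scheme \<Rightarrow> nat \<Rightarrow> ('a \<Rightarrow> complex mat) \<Rightarrow> bool" where
  "irreducible_representation G n \<rho> \<longleftrightarrow>
     representation G n \<rho> \<and> n > 0 \<and>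
     (\<forall>W. VectorSpace.subspace class_ring W (module_vec TYPE(complex) n) \<and>
          (\<forall>g\<in>carrier G. \<forall>w\<in>W. \<rho> g *\<^sub>v w \<in> W)
        \<longrightarrow> W = {0\<^sub>v n} \<or> W = carrier_vec n)"

definition mat_trace :: "complex mat \<Rightarrow> complex" where
  "mat_trace A = (\<Sum>i<dim_row A. A $$ (i, i))"

text \<open>Class functions are undefined outside the carrier, so that each character of \<open>G\<close> is
  represented by exactly one HOL function.\<close>

definition character :: "('a, 'b) monoid_scheme \<Rightarrow> ('a \<Rightarrow> complex mat) \<Rightarrow> 'a \<Rightarrow> complex" where
  "character G \<rho> = (\<lambda>g\<in>carrier G. mat_trace (\<rho> g))"

definition Irr :: "('a, 'b) monoid_scheme \<Rightarrow> ('a \<Rightarrow> complex) set" where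
  "Irr G = {character G \<rho> | n \<rho>. irreducible_representation G n \<rho>}"

definition principal_character :: "'a set \<Rightarrow> 'a \<Rightarrow> complex" where
  "principal_character M = (\<lambda>g\<in>M. 1)"

text \<open>The usual induction formula: \<open>\<phi>\<close> is extended by zero from \<open>M\<close> to \<open>G\<close>
  and then averaged over conjugates.\<close>

definition induced :: "('a, 'b) monoid_scheme \<Rightarrow> 'a set \<Rightarrow> ('a \<Rightarrow> complex) \<Rightarrow> 'a \<Rightarrow> complex" where
  "induced G M \<phi> = (\<lambda>g\<in>carrier G. 1 / of_nat (card M) *
     (\<Sum>x\<in>carrier G. let y = x \<otimes>\<^bsub>G\<^esub> g \<otimes>\<^bsub>G\<^esub> inv\<^bsub>G\<^esub> x in if y \<in> M then \<phi> y else 0))"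

definition char_inner ::
    "('a, 'b) monoid_scheme \<Rightarrow> ('a \<Rightarrow> complex) \<Rightarrow> ('a \<Rightarrow> complex) \<Rightarrow> complex" where
  "char_inner G \<alpha> \<beta> =
     1 / of_nat (Coset.order G) * (\<Sum>g\<in>carrier G. \<alpha> g * cnj (\<beta> g))"

definition P_pi_character :: "nat set \<Rightarrow> ('a, 'b) monoid_scheme \<Rightarrow> ('a \<Rightarrow> complex) \<Rightarrow> bool" where
  "P_pi_character \<pi> G \<chi> \<longleftrightarrow>
     \<chi> \<in> Irr G \<and>
     (\<exists>M. maximal_subgroup M G \<and> pi_number \<pi> (group_index G M) \<and>
          char_inner G \<chi> (induced G M (principal_character M)) \<noteq> 0)"

end

theory Submission
  imports Defs "HOL-Algebra.Sylow" "HOL-Algebra.Zassenhaus" "HOL-Algebra.Multiplicative_Group"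
    "Jordan_Normal_Form.Spectral_Radius"
begin

text \<open>If \<open>H\<close> is a normal \<open>\<pi>\<close>-complement, then every maximal subgroup \<open>M\<close> of \<open>\<pi>\<close>-index contains \<open>H\<close>. A
  constituent of \<open>(1\<^sub>M)\<^sup>G\<close> has nonzero \<open>M\<close>-fixed vectors, so the \<open>H\<close>-fixed vectors form a nonzero
  invariant subspace; hence \<open>H\<close> lies in the kernel and the degree divides \<open>|G : H|\<close>.

  For the converse, climb down a chief series. If \<open>N\<close> is a minimal normal elementary abelian
  \<open>p\<close>-subgroup and \<open>X / N\<close> is a normal \<open>\<pi>\<close>-complement of \<open>G / N\<close>, let \<open>H\<close> be a complement of \<open>N\<close> in \<open>X\<close>.
  If \<open>H\<close> is not normal in \<open>G\<close>, the Frattini argument yields a maximal subgroup \<open>M\<close> complementing \<open>N\<close>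
  in \<open>G\<close>. For every linear character \<open>\<mu>\<close> of \<open>N\<close> the permutation character \<open>(1\<^sub>M)\<^sup>G\<close> has an irreducible
  constituent whose degree is the length of the \<open>G\<close>-orbit of \<open>\<mu>\<close>. As this length is a \<open>\<pi>\<close>-number, \<open>X\<close>
  fixes \<open>\<mu>\<close>; so \<open>X\<close> centralizes \<open>N\<close>, and then \<open>H\<close> is normal after all.\<close>

section \<open>Subgroups of coprime index and complements\<close>

text \<open>Passing to a quotient changes the element type, so the induction runs over the normal
  subgroups \<open>L\<close> of one fixed \<open>G\<close>, downwards from \<open>carrier G\<close>;
  only the single step takes place in \<open>G Mod L\<close>. The degree hypothesis survives there
  because P_pi-characters inflate. A chief factor that is a pi'-group costs nothing, since it is
  absorbed into the index of \<open>L\<close> in \<open>X\<close>. At an abelian factor the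
  complement \<open>M\<close> has index |N|, a pi-number, and this is what brings the constituents
  of its permutation character under the degree hypothesis. The orbit length is also the index of
  the stabilizer of \<open>\<mu>\<close>, which contains \<open>N\<close>; as |X : N| is a
  pi'-number, coprimality pushes \<open>X\<close> into the stabilizer. Linear characters separate
  the points of \<open>N\<close>, whence \<open>X\<close> centralizes \<open>N\<close>. Every
  conjugate of \<open>H\<close> lies in \<open>X\<close> and is brought back to \<open>H\<close> by
  conjugation with an element of \<open>N\<close>; that conjugation has now become trivial, so the
  conjugate was in \<open>H\<close> already.\<close>

lemma pi_number_mult: "pi_number \<pi> (a * b) \<longleftrightarrow> pi_number \<pi> a \<and> pi_number \<pi> b"
  unfolding pi_number_def by (auto simp: prime_dvd_mult_iff)

lemma pi_number_dvd: "pi_number \<pi> n \<Longrightarrow> d dvd n \<Longrightarrow> pi_number \<pi> d"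
  by (auto simp: dvd_def pi_number_mult)

lemma pi_number_1 [simp]: "pi_number \<pi> (Suc 0)"
  by (auto simp: pi_number_def)

lemma pi_number_coprime:
  assumes "pi_number \<pi> a" "pi_number (prime_complement \<pi>) b"
  shows "coprime a b"
proof (rule ccontr)
  assume "\<not> coprime a b"
  then obtain p where "prime p" "p dvd a" "p dvd b"
    by (metis coprimeI is_unit_gcd gcd_dvd1 gcd_dvd2 dvd_trans prime_factor_nat nat_dvd_1_iff_1 coprime_iff_gcd_eq_1)
  then show False using assms by (auto simp: pi_number_def prime_complement_def)
qed

lemma pi_number_both:
  assumes "pi_number \<pi> a" "pi_number (prime_complement \<pi>) a"
  shows "a = 1"
  using pi_number_coprime[OF assms] by simp

context group
begin

lemma inv_cancel_left:
  assumes "x \<in> carrier G" "y \<in> carrier G"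
  shows "inv x \<otimes> (x \<otimes> y) = y" "x \<otimes> (inv x \<otimes> y) = y"
  using assms by (simp_all add: m_assoc[symmetric])

lemmas group_simps = m_assoc inv_cancel_left inv_mult_group

lemma card_subgroup_pos: "finite (carrier G) \<Longrightarrow> subgroup H G \<Longrightarrow> card H > 0"
  by (metis card_gt_0_iff finite_subset subgroup.subset subgroup.one_closed empty_iff)

lemma group_index_mult: "finite (carrier G) \<Longrightarrow> subgroup H G \<Longrightarrow> group_index G H * card H = card (carrier G)"
  using lagrange[of H] by (simp add: group_index_def Coset.order_def)

lemma card_subgroup_dvd:
  assumes "finite (carrier G)" "subgroup H G" "subgroup K G" "H \<subseteq> K"
  shows "card H dvd card K"
proof -
  interpret K: group "G\<lparr>carrier := K\<rparr>" using assms(3) by (rule subgroup_imp_group)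
  have "subgroup H (G\<lparr>carrier := K\<rparr>)" using assms by (simp add: subgroup_incl)
  from K.lagrange[OF this] have "card (rcosets\<^bsub>G\<lparr>carrier := K\<rparr>\<^esub> H) * card H = card K"
    by (simp add: Coset.order_def)
  then show ?thesis by (metis dvd_triv_right)
qed

text \<open>Fix one factorization \<open>a y \<otimes> b y\<close> of each product \<open>y\<close>.
  All others arise by moving an element \<open>d\<close> of the intersection across, as
  \<open>(a y \<otimes> d, inv d \<otimes> b y)\<close>, so pairs \<open>(y, d)\<close> correspond
  to pairs in \<open>H \<times> K\<close>.\<close>

lemma card_set_mult:
  assumes H: "subgroup H G" and K: "subgroup K G"
  shows "card (H <#> K) * card (H \<inter> K) = card H * card K"
proof -
  interpret H: subgroup H G by fact
  interpret K: subgroup K G by fact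
  have "\<forall>y\<in>H <#> K. \<exists>a b. a \<in> H \<and> b \<in> K \<and> y = a \<otimes> b" by (auto simp: set_mult_def)
  then obtain a b where ab: "\<And>y. y \<in> H <#> K \<Longrightarrow> a y \<in> H \<and> b y \<in> K \<and> y = a y \<otimes> b y"
    by metis
  have "bij_betw (\<lambda>(y,d). (a y \<otimes> d, inv d \<otimes> b y)) ((H <#> K) \<times> (H \<inter> K)) (H \<times> K)"
  proof (rule bij_betwI')
    fix x y assume x: "x \<in> (H <#> K) \<times> (H \<inter> K)" and y: "y \<in> (H <#> K) \<times> (H \<inter> K)"
    obtain u d where xx: "x = (u,d)" by force
    obtain v e where yy: "y = (v,e)" by force
    from x xx have u: "u \<in> H <#> K" "d \<in> H" "d \<in> K" by auto
    from y yy have v: "v \<in> H <#> K" "e \<in> H" "e \<in> K" by auto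
    show "((case x of (y, d) \<Rightarrow> (a y \<otimes> d, inv d \<otimes> b y)) = (case y of (y, d) \<Rightarrow> (a y \<otimes> d, inv d \<otimes> b y))) = (x = y)"
    proof
      assume "(case x of (y, d) \<Rightarrow> (a y \<otimes> d, inv d \<otimes> b y)) = (case y of (y, d) \<Rightarrow> (a y \<otimes> d, inv d \<otimes> b y))"
      then have e: "a u \<otimes> d = a v \<otimes> e" "inv d \<otimes> b u = inv e \<otimes> b v" by (auto simp: xx yy)
      have c: "a u \<in> carrier G" "a v \<in> carrier G" "b u \<in> carrier G" "b v \<in> carrier G"
        "d \<in> carrier G" "e \<in> carrier G"
        using ab[OF u(1)] ab[OF v(1)] u v by auto
      have "u = (a u \<otimes> d) \<otimes> (inv d \<otimes> b u)" using ab[OF u(1)] c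
        by (simp add: group_simps)
      also have "\<dots> = (a v \<otimes> e) \<otimes> (inv e \<otimes> b v)" using e by simp
      also have "\<dots> = v" using ab[OF v(1)] c by (simp add: group_simps)
      finally have "u = v" .
      with e c show "x = y" by (simp add: xx yy)
    qed simp
  next
    fix x assume "x \<in> (H <#> K) \<times> (H \<inter> K)"
    then show "(case x of (y, d) \<Rightarrow> (a y \<otimes> d, inv d \<otimes> b y)) \<in> H \<times> K"
      using ab by auto
  next
    fix z assume "z \<in> H \<times> K"
    then obtain h k where z: "z = (h,k)" "h \<in> H" "k \<in> K" by auto
    define y where "y = h \<otimes> k"
    have y: "y \<in> H <#> K" using z by (auto simp: set_mult_def y_def)
    note aby = ab[OF y]
    define d where "d = inv (a y) \<otimes> h"
    have c: "a y \<in> carrier G" "b y \<in> carrier G" "h \<in> carrier G" "k \<in> carrier G" using aby z by auto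
    have "h = a y \<otimes> b y \<otimes> inv k" using aby c y_def
      by (metis inv_solve_right m_closed)
    then have "d = b y \<otimes> inv k" unfolding d_def using c by (simp add: group_simps)
    then have d: "d \<in> H \<inter> K" using d_def aby z
      by (metis H.m_closed H.m_inv_closed IntI K.m_closed K.m_inv_closed)
    have 1: "a y \<otimes> d = h" unfolding d_def using c by (simp add: group_simps)
    have 2: "inv d \<otimes> b y = k" using \<open>d = b y \<otimes> inv k\<close> c
      by (simp add: group_simps)
    show "\<exists>x\<in>(H <#> K) \<times> (H \<inter> K). z = (case x of (y, d) \<Rightarrow> (a y \<otimes> d, inv d \<otimes> b y))"
      using 1 2 d y z by (intro bexI[of _ "(y,d)"]) auto
  qed
  from bij_betw_same_card[OF this] show ?thesis by (simp add: card_cartesian_product)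
qed

text \<open>|AS : S| = |A : A \<inter> S| divides both the pi-number |G : S| and the pi'-number |A :
  B|, so it is 1. With trivial \<open>B\<close> this puts a normal pi-complement into maximal
  subgroups of pi-index; with \<open>B = N\<close> it puts \<open>X\<close> into the stabilizer of a
  linear character.\<close>

lemma normal_subset_of_index:
  assumes fin: "finite (carrier G)" and A: "A \<lhd> G" and S: "subgroup S G"
    and B: "subgroup B G" "B \<subseteq> A" "B \<subseteq> S"
    and card: "card A = card B * m" "pi_number (prime_complement \<pi>) m"
    and ind: "pi_number \<pi> (group_index G S)"
  shows "A \<subseteq> S"
proof -
  have As: "subgroup A G" using A by (rule normal_imp_subgroup)
  have AS: "subgroup (A <#> S) G"
    using A S by (simp add: mult_norm_subgroup)
  have sub: "S \<subseteq> A <#> S" "A \<subseteq> A <#> S"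
    using subgroup.one_closed[OF As] subgroup.one_closed[OF S] subgroup.subset[OF S] subgroup.subset[OF As]
    by (force simp: set_mult_def)+
  obtain k where k: "card (A <#> S) = card S * k"
    using card_subgroup_dvd[OF fin S AS sub(1)] by (auto simp: dvd_def)
  obtain l where "card (carrier G) = card (A <#> S) * l"
    using card_subgroup_dvd[OF fin AS subgroup_self] subgroup.subset[OF AS] by (auto simp: dvd_def)
  with k group_index_mult[OF fin S] card_subgroup_pos[OF fin S]
  have "group_index G S = k * l" by (simp add: mult_ac) 
  with ind have k1: "pi_number \<pi> k" by (simp add: pi_number_mult)
  have AiS: "subgroup (A \<inter> S) G" using As S by (rule subgroups_Inter_pair)
  obtain t where t: "card (A \<inter> S) = card B * t"
    using card_subgroup_dvd[OF fin B(1) AiS] B by (auto simp: dvd_def)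
  have "card S * k * (card B * t) = card B * m * card S"
    using card_set_mult[OF As S] k t card(1) by simp
  then have "k * t = m" using card_subgroup_pos[OF fin S] card_subgroup_pos[OF fin B(1)] by (simp add: mult_ac)
  then have "pi_number (prime_complement \<pi>) k" using card(2) by (auto simp: pi_number_mult)
  with k1 have "k = 1" by (rule pi_number_both)
  then have "card (A <#> S) = card S" using k by simp
  then have "S = A <#> S" using sub(1) fin subgroup.subset[OF AS]
    by (metis card_subset_eq finite_subset)
  with sub show ?thesis by simp
qed

section \<open>Crossed homomorphisms and complements of abelian normal subgroups\<close>

lemma abelian_subgroup_comm_group:
  assumes "subgroup N G" "\<And>x y. x \<in> N \<Longrightarrow> y \<in> N \<Longrightarrow> x \<otimes> y = y \<otimes> x"
  shows "comm_group (G\<lparr>carrier := N\<rparr>)"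
  using subgroup_imp_group[OF assms(1)] assms(2) by (intro group.group_comm_groupI) auto

lemma finprod_conj:
  assumes N: "N \<lhd> G" and ab: "\<And>x y. x \<in> N \<Longrightarrow> y \<in> N \<Longrightarrow> x \<otimes> y = y \<otimes> x"
    and k: "k \<in> carrier G" and S: "finite S" and f: "\<And>t. t \<in> S \<Longrightarrow> f t \<in> N"
  shows "finprod (G\<lparr>carrier := N\<rparr>) (\<lambda>t. k \<otimes> f t \<otimes> inv k) S = k \<otimes> finprod (G\<lparr>carrier := N\<rparr>) f S \<otimes> inv k"
proof -
  interpret N: normal N G by fact
  interpret A: comm_group "G\<lparr>carrier := N\<rparr>"
    using N.subgroup_axioms ab by (rule abelian_subgroup_comm_group)
  show ?thesis
    using S f
  proof (induction S)
    case empty then show ?case using k by simp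
  next
    case (insert t S)
    have fS: "\<And>s. s \<in> S \<Longrightarrow> f s \<in> N" "f t \<in> N" using insert by auto
    have 1: "finprod (G\<lparr>carrier := N\<rparr>) f S \<in> N" using A.finprod_closed[of f S] fS by auto
    have 2: "\<And>s. s \<in> insert t S \<Longrightarrow> k \<otimes> f s \<otimes> inv k \<in> N" using fS k N.inv_op_closed2 by auto
    have "finprod (G\<lparr>carrier := N\<rparr>) (\<lambda>t. k \<otimes> f t \<otimes> inv k) (insert t S)
        = (k \<otimes> f t \<otimes> inv k) \<otimes> (k \<otimes> finprod (G\<lparr>carrier := N\<rparr>) f S \<otimes> inv k)"
      using insert 2 A.finprod_insert[of S t "\<lambda>t. k \<otimes> f t \<otimes> inv k"] by (auto simp: Pi_def)
    also have "\<dots> = k \<otimes> (f t \<otimes> finprod (G\<lparr>carrier := N\<rparr>) f S) \<otimes> inv k"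
      using 1 fS k by (simp add: group_simps)
    also have "f t \<otimes> finprod (G\<lparr>carrier := N\<rparr>) f S = finprod (G\<lparr>carrier := N\<rparr>) f (insert t S)"
      using insert fS A.finprod_insert[of S t f] by (auto simp: Pi_def)
    finally show ?case .
  qed
qed

lemma conj_pow:
  assumes "l \<in> carrier G" "x \<in> carrier G"
  shows "l \<otimes> (x [^] (k::nat)) \<otimes> inv l = (l \<otimes> x \<otimes> inv l) [^] k"
proof (induction k)
  case (Suc k)
  have "l \<otimes> (x [^] Suc k) \<otimes> inv l = (l \<otimes> (x [^] k) \<otimes> inv l) \<otimes> (l \<otimes> x \<otimes> inv l)"
    using assms by (simp add: group_simps)
  with Suc show ?case by simp
qed (use assms in simp)

text \<open>The crossed homomorphism is the product over a transversal \<open>T\<close> of the elements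
  \<open>k t (r (k t))\<^sup>-\<^sup>1\<close>, where \<open>r\<close> maps an element to the representative of its coset.\<close>

lemma exists_crossed_hom:
  assumes fin: "finite (carrier G)" and N: "N \<lhd> G"
    and ab: "\<And>x y. x \<in> N \<Longrightarrow> y \<in> N \<Longrightarrow> x \<otimes> y = y \<otimes> x"
    and X: "subgroup X G" and NX: "N \<subseteq> X" and card: "card X = card N * m"
  obtains c where "\<And>x. x \<in> X \<Longrightarrow> c x \<in> N"
    and "\<And>x y. x \<in> X \<Longrightarrow> y \<in> X \<Longrightarrow> c (x \<otimes> y) = (x \<otimes> c y \<otimes> inv x) \<otimes> c x"
    and "\<And>n. n \<in> N \<Longrightarrow> c n = n [^] m"
proof -
  interpret N: normal N G by fact
  interpret X: subgroup X G by fact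
  interpret A: comm_group "G\<lparr>carrier := N\<rparr>"
    using subgroup_imp_group[OF N.subgroup_axioms] ab by (intro group.group_comm_groupI) auto
  have finN: "finite N" using fin N.subset finite_subset by blast
  have finX: "finite X" using fin X.subset finite_subset by blast
  \<comment> \<open>The choice is made from the coset as a set, so \<open>r\<close> is constant on
    cosets of \<open>N\<close>; this is all that \<open>rn\<close> needs.\<close>
  define r where "r x = (SOME y. y \<in> N #> x)" for x
  have ex: "\<exists>n\<in>N. r x = n \<otimes> x" if "x \<in> carrier G" for x
  proof -
    have "x \<in> N #> x" using that N.subgroup_axioms by (simp add: rcos_self)
    then have "r x \<in> N #> x" unfolding r_def by (rule someI)
    then show ?thesis by (auto simp: r_coset_def)
  qed
  have rX: "r x \<in> X" if "x \<in> X" for x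
    using ex[of x] that NX X.subset by auto
  have rn: "r (n \<otimes> x) = r x" if "n \<in> N" "x \<in> carrier G" for n x
  proof -
    have "N #> (n \<otimes> x) = N #> x"
      using that N.subset N.rcos_const[OF is_group that(1)] coset_mult_assoc[of N n x] by auto
    then show ?thesis by (simp add: r_def)
  qed
  have rr: "r (r x) = r x" if "x \<in> carrier G" for x
    using ex[OF that] rn that by auto
  \<comment> \<open>By normality of \<open>N\<close>, left multiplication by \<open>k\<close>
    permutes the cosets, hence also their representatives.\<close>
  have rk: "r (k \<otimes> r x) = r (k \<otimes> x)" if k: "k \<in> carrier G" and x: "x \<in> carrier G" for k x
  proof -
    obtain n where n: "n \<in> N" "r x = n \<otimes> x" using ex[OF x] by auto
    have "k \<otimes> r x = (k \<otimes> n \<otimes> inv k) \<otimes> (k \<otimes> x)" using n k x by (simp add: group_simps)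
    with rn[of "k \<otimes> n \<otimes> inv k" "k \<otimes> x"] show ?thesis using n k x N.inv_op_closed2 by simp
  qed
  define T where "T = r ` X"
  have TX: "T \<subseteq> X" using rX by (auto simp: T_def)
  have TG: "t \<in> carrier G" if "t \<in> T" for t using TX that X.subset by auto
  have rT: "r t = t" if "t \<in> T" for t using that rr X.subset by (auto simp: T_def)
  have finT: "finite T" using finX by (simp add: T_def)
  have "bij_betw (\<lambda>(n,t). n \<otimes> t) (N \<times> T) X"
  proof (rule bij_betw_imageI)
    show "inj_on (\<lambda>(n,t). n \<otimes> t) (N \<times> T)"
    proof (rule inj_onI, clarify)
      fix n t n' t' assume a: "n \<in> N" "t \<in> T" "n' \<in> N" "t' \<in> T" "n \<otimes> t = n' \<otimes> t'"
      then have "t = t'" using rn rT TG by metis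
      then show "n = n' \<and> t = t'" using a TG by simp
    qed
    show "(\<lambda>(n,t). n \<otimes> t) ` (N \<times> T) = X"
    proof
      show "(\<lambda>(n,t). n \<otimes> t) ` (N \<times> T) \<subseteq> X" using NX TX by auto
      show "X \<subseteq> (\<lambda>(n,t). n \<otimes> t) ` (N \<times> T)"
      proof
        fix x assume x: "x \<in> X"
        then obtain n where n: "n \<in> N" "r x = n \<otimes> x" using ex X.subset by blast
        then have "x = inv n \<otimes> r x" using x X.subset by (simp add: group_simps)
        with n x show "x \<in> (\<lambda>(n,t). n \<otimes> t) ` (N \<times> T)"
          by (intro image_eqI[of _ _ "(inv n, r x)"]) (force simp: T_def)+
      qed
    qed
  qed
  from bij_betw_same_card[OF this] have cT: "card T = m"
    using card card_subgroup_pos[OF fin N.subgroup_axioms] by (simp add: card_cartesian_product)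
  have kt: "k \<otimes> t \<otimes> inv (r (k \<otimes> t)) \<in> N" if "k \<in> X" "t \<in> X" for k t
  proof -
    have c: "k \<in> carrier G" "t \<in> carrier G" using that X.subset by auto
    then obtain n where n: "n \<in> N" "r (k \<otimes> t) = n \<otimes> (k \<otimes> t)" using ex[of "k \<otimes> t"] by auto
    then have "k \<otimes> t \<otimes> inv (r (k \<otimes> t)) = inv n" using c by (simp add: group_simps)
    then show ?thesis using n by simp
  qed
  define P where "P f = finprod (G\<lparr>carrier := N\<rparr>) f T" for f
  define c where "c k = P (\<lambda>t. k \<otimes> t \<otimes> inv (r (k \<otimes> t)))" for k
  have Pcl: "P f \<in> N" if "\<And>t. t \<in> T \<Longrightarrow> f t \<in> N" for f
    using A.finprod_closed[of f T] that by (auto simp: P_def)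
  have Pmult: "P (\<lambda>t. f t \<otimes> g t) = P f \<otimes> P g"
    if "\<And>t. t \<in> T \<Longrightarrow> f t \<in> N" "\<And>t. t \<in> T \<Longrightarrow> g t \<in> N" for f g
    using A.finprod_multf[of f T g] that by (auto simp: P_def)
  have Pconj: "P (\<lambda>t. k \<otimes> f t \<otimes> inv k) = k \<otimes> P f \<otimes> inv k"
    if "k \<in> X" "\<And>t. t \<in> T \<Longrightarrow> f t \<in> N" for f k
    unfolding P_def using that finT X.subset by (intro finprod_conj[OF N ab]) auto
  have Pcong: "P f = P g" if "\<And>t. t \<in> T \<Longrightarrow> f t = g t" "\<And>t. t \<in> T \<Longrightarrow> g t \<in> N" for f g
    unfolding P_def by (rule A.finprod_cong') (use that in auto)
  show thesis
  proof
    show "c x \<in> N" if "x \<in> X" for x unfolding c_def using kt that TX by (intro Pcl) auto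
  next
    fix k l assume k: "k \<in> X" and l: "l \<in> X"
    have kG: "k \<in> carrier G" "l \<in> carrier G" using k l X.subset by auto
    define f where "f t = l \<otimes> t \<otimes> inv (r (l \<otimes> t))" for t
    define g where "g t = k \<otimes> t \<otimes> inv (r (k \<otimes> t))" for t
    have fN: "\<And>t. t \<in> T \<Longrightarrow> f t \<in> N" and gN: "\<And>t. t \<in> T \<Longrightarrow> g t \<in> N"
      using kt k l TX by (auto simp: f_def g_def)
    have rlT: "r (l \<otimes> t) \<in> T" if "t \<in> T" for t using that l TX by (auto simp: T_def)
    have inj: "inj_on (\<lambda>t. r (l \<otimes> t)) T"
    proof (rule inj_onI)
      fix t t' assume a: "t \<in> T" "t' \<in> T" "r (l \<otimes> t) = r (l \<otimes> t')"
      have "r (inv l \<otimes> r (l \<otimes> t)) = r (inv l \<otimes> r (l \<otimes> t'))" using a by simp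
      then have "r (inv l \<otimes> (l \<otimes> t)) = r (inv l \<otimes> (l \<otimes> t'))"
        using rk[of "inv l" "l \<otimes> t"] rk[of "inv l" "l \<otimes> t'"] a(1,2) kG TG by auto
      then show "t = t'" using a kG TG rT by (simp add: group_simps)
    qed
    have bij: "(\<lambda>t. r (l \<otimes> t)) ` T = T"
      using inj rlT finT by (intro endo_inj_surj) auto
    \<comment> \<open>Insert \<open>inv (r (l \<otimes> t))\<close> and
      \<open>r (l \<otimes> t)\<close> between \<open>l \<otimes> t\<close> and the last factor:
      each factor of \<open>c (k \<otimes> l)\<close> splits into a conjugate of one of
      \<open>c l\<close> and a factor of \<open>c k\<close> at the point
      \<open>r (l \<otimes> t)\<close>. This point runs through \<open>T\<close> together with
      \<open>t\<close>, so the second product can be reindexed.\<close>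
    have "c (k \<otimes> l) = P (\<lambda>t. (k \<otimes> f t \<otimes> inv k) \<otimes> g (r (l \<otimes> t)))"
      unfolding c_def
    proof (rule Pcong)
      fix t assume t: "t \<in> T"
      have rlG: "r (l \<otimes> t) \<in> carrier G" using rlT[OF t] TG by auto
      have rkG: "r (k \<otimes> (l \<otimes> t)) \<in> carrier G" using rX[of "k \<otimes> (l \<otimes> t)"] t k l TX X.subset by blast
      show "k \<otimes> l \<otimes> t \<otimes> inv r (k \<otimes> l \<otimes> t) = k \<otimes> f t \<otimes> inv k \<otimes> g (r (l \<otimes> t))"
        using rlG rkG kG TG[OF t] by (simp add: f_def g_def rk group_simps)
    next
      fix t assume t: "t \<in> T"
      then show "(k \<otimes> f t \<otimes> inv k) \<otimes> g (r (l \<otimes> t)) \<in> N"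
        using fN gN rlT kG N.inv_op_closed2 by auto
    qed
    also have "\<dots> = P (\<lambda>t. k \<otimes> f t \<otimes> inv k) \<otimes> P (\<lambda>t. g (r (l \<otimes> t)))"
      using fN gN rlT kG N.inv_op_closed2 by (intro Pmult) auto
    also have "P (\<lambda>t. k \<otimes> f t \<otimes> inv k) = k \<otimes> P f \<otimes> inv k" using Pconj k fN by blast
    also have "P (\<lambda>t. g (r (l \<otimes> t))) = P g"
      unfolding P_def using A.finprod_reindex[of g "\<lambda>t. r (l \<otimes> t)" T] inj bij gN
      by (auto simp: Pi_def)
    finally show "c (k \<otimes> l) = k \<otimes> c l \<otimes> inv k \<otimes> c k" by (simp add: c_def f_def[abs_def] g_def[abs_def])
  next
    fix n assume n: "n \<in> N"
    \<comment> \<open>For \<open>n\<close> in \<open>N\<close> the representative of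
      \<open>n \<otimes> t\<close> is \<open>t\<close> itself, so every factor equals
      \<open>n\<close>.\<close>
    have "c n = P (\<lambda>t. n)" unfolding c_def
      using n TG by (intro Pcong) (simp_all add: rn rT group_simps)
    also have "\<dots> = n [^]\<^bsub>G\<lparr>carrier := N\<rparr>\<^esub> card T"
      unfolding P_def using n by (intro A.finprod_const) auto
    finally show "c n = n [^] m" using cT by (simp add: nat_pow_consistent[symmetric])
  qed
qed

text \<open>\<open>u\<close> is an inverse of \<open>m\<close> modulo |N|, from Bezout. Extracting
  the root by a power makes it commute with conjugation and, in abelian \<open>N\<close>, with
  products.\<close>

lemma coprime_pow_root:
  assumes "subgroup N G" "m \<noteq> 0" "coprime m (card N)"
  obtains u :: nat where "\<And>x. x \<in> N \<Longrightarrow> (x [^] u) [^] m = x"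
proof -
  interpret N: subgroup N G by fact
  interpret A: group "G\<lparr>carrier := N\<rparr>" using assms(1) by (rule subgroup_imp_group)
  obtain u y where uy: "m * u = card N * y + 1" using bezout_nat[OF assms(2), of "card N"] assms(3) by auto
  have "(x [^] u) [^] m = x" if "x \<in> N" for x
  proof -
    have xG: "x \<in> carrier G" using that by simp
    have "(x [^] u) [^] m = x [^] (card N * y + 1)"
      using xG uy by (simp add: nat_pow_pow mult.commute)
    also have "\<dots> = (x [^] card N) [^] y \<otimes> x" using xG by (simp add: nat_pow_mult[symmetric] nat_pow_pow)
    also have "x [^] card N = \<one>"
      using A.pow_order_eq_1[of x] that by (simp add: nat_pow_consistent[symmetric] Coset.order_def)
    finally show ?thesis using xG by simp
  qed
  then show thesis by (rule that)
qed

text \<open>Averaging \<open>c\<close> over \<open>H\<close> shows that \<open>c\<close> is a coboundary on \<open>H\<close>.\<close>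

lemma crossed_hom_conj:
  assumes fin: "finite (carrier G)" and N: "N \<lhd> G"
    and ab: "\<And>x y. x \<in> N \<Longrightarrow> y \<in> N \<Longrightarrow> x \<otimes> y = y \<otimes> x"
    and X: "subgroup X G" and NX: "N \<subseteq> X"
    and cN: "\<And>x. x \<in> X \<Longrightarrow> c x \<in> N"
    and cmult: "\<And>x y. x \<in> X \<Longrightarrow> y \<in> X \<Longrightarrow> c (x \<otimes> y) = (x \<otimes> c y \<otimes> inv x) \<otimes> c x"
    and cpow: "\<And>n. n \<in> N \<Longrightarrow> c n = n [^] m"
    and cop: "coprime m (card N)"
    and H: "subgroup H G" "H \<subseteq> X" "card H = m"
  obtains n where "n \<in> N" "\<And>h. h \<in> H \<Longrightarrow> c (n \<otimes> h \<otimes> inv n) = \<one>"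
proof -
  interpret N: normal N G by fact
  interpret X: subgroup X G by fact
  interpret H: subgroup H G by fact
  interpret A: comm_group "G\<lparr>carrier := N\<rparr>"
    using N.subgroup_axioms ab by (rule abelian_subgroup_comm_group)
  have m0: "m \<noteq> 0" using card_subgroup_pos[OF fin H(1)] H(3) by simp
  obtain u where root: "\<And>x. x \<in> N \<Longrightarrow> (x [^] (u::nat)) [^] m = x"
    using coprime_pow_root[OF N.subgroup_axioms m0 cop] by blast
  have powN: "x [^]\<^bsub>G\<lparr>carrier := N\<rparr>\<^esub> (k::nat) = x [^] k" for x k by (simp add: nat_pow_consistent[symmetric])
  have pN: "x [^] (k::nat) \<in> N" if "x \<in> N" for x k using A.nat_pow_closed[of x k] that by (simp add: powN)
  have root': "(x [^] m) [^] u = x" if "x \<in> N" for x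
    using root[OF that] that by (simp add: nat_pow_pow mult.commute)
  define a where "a = finprod (G\<lparr>carrier := N\<rparr>) c H"
  have finH: "finite H" using fin H.subset finite_subset by blast
  have cH: "c h \<in> N" if "h \<in> H" for h using that cN H by auto
  have aN: "a \<in> N" unfolding a_def using A.finprod_closed[of c H] cH by auto
  \<comment> \<open>\<open>b\<close> is the m-th root of the product of \<open>c\<close> over
    \<open>H\<close>. Translating that product by \<open>l\<close> gives
    \<open>a = (l \<otimes> a \<otimes> inv l) \<otimes> c l [^] m\<close>, and taking u-th powers
    turns this into the coboundary identity for \<open>b\<close>.\<close>
  define b where "b = a [^] u"
  have bN: "b \<in> N" unfolding b_def using aN by (rule pN)
  have b: "b = (l \<otimes> b \<otimes> inv l) \<otimes> c l" if l: "l \<in> H" for l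
  proof -
    have lG: "l \<in> carrier G" using l by simp
    have "bij_betw (\<lambda>h. l \<otimes> h) H H"
    proof (rule bij_betw_imageI)
      show inj: "inj_on (\<lambda>h. l \<otimes> h) H" using lG by (auto intro!: inj_onI)
      show "(\<lambda>h. l \<otimes> h) ` H = H" using inj finH l by (intro endo_inj_surj) auto
    qed
    then have "a = finprod (G\<lparr>carrier := N\<rparr>) (\<lambda>h. c (l \<otimes> h)) H"
      unfolding a_def using A.finprod_reindex[of c "\<lambda>h. l \<otimes> h" H] cH by (auto simp: Pi_def bij_betw_def)
    also have "\<dots> = finprod (G\<lparr>carrier := N\<rparr>) (\<lambda>h. (l \<otimes> c h \<otimes> inv l) \<otimes>\<^bsub>G\<lparr>carrier := N\<rparr>\<^esub> c l) H"
    proof (rule A.finprod_cong')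
      show "(\<lambda>h. (l \<otimes> c h \<otimes> inv l) \<otimes>\<^bsub>G\<lparr>carrier := N\<rparr>\<^esub> c l) \<in> H \<rightarrow> carrier (G\<lparr>carrier := N\<rparr>)"
        using cH l lG N.inv_op_closed2 by auto
      fix h assume "h \<in> H"
      then show "c (l \<otimes> h) = (l \<otimes> c h \<otimes> inv l) \<otimes>\<^bsub>G\<lparr>carrier := N\<rparr>\<^esub> c l"
        using cmult l H by auto
    qed simp
    also have "\<dots> = finprod (G\<lparr>carrier := N\<rparr>) (\<lambda>h. l \<otimes> c h \<otimes> inv l) H
        \<otimes>\<^bsub>G\<lparr>carrier := N\<rparr>\<^esub> finprod (G\<lparr>carrier := N\<rparr>) (\<lambda>h. c l) H"
      using cH l lG N.inv_op_closed2 by (intro A.finprod_multf) auto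
    also have "finprod (G\<lparr>carrier := N\<rparr>) (\<lambda>h. l \<otimes> c h \<otimes> inv l) H = l \<otimes> a \<otimes> inv l"
      unfolding a_def using lG finH cH by (intro finprod_conj[OF N ab]) auto
    also have "finprod (G\<lparr>carrier := N\<rparr>) (\<lambda>h. c l) H = c l [^] m"
      using A.finprod_const[of "c l" H] cH l H(3) by (simp add: powN)
    finally have "a = (l \<otimes> a \<otimes> inv l) \<otimes> c l [^] m" by simp
    then have "b = ((l \<otimes> a \<otimes> inv l) \<otimes> c l [^] m) [^] u" by (simp add: b_def)
    also have "\<dots> = (l \<otimes> a \<otimes> inv l) [^] u \<otimes> (c l [^] m) [^] u"
      using A.nat_pow_distrib[of "l \<otimes> a \<otimes> inv l" "c l [^] m" u] aN lG cH[OF l] pN N.inv_op_closed2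
      by (simp add: powN)
    also have "\<dots> = (l \<otimes> b \<otimes> inv l) \<otimes> c l"
      using conj_pow[OF lG, of a u] aN root'[OF cH[OF l]] by (simp add: b_def)
    finally show ?thesis .
  qed
  \<comment> \<open>Chosen so that \<open>c n = n [^] m\<close> is \<open>inv b\<close> and
    \<open>c (inv n)\<close> is \<open>b\<close>; the crossed homomorphism law then collapses on
    \<open>n \<otimes> l \<otimes> inv n\<close>.\<close>
  define n where "n = inv (b [^] u)"
  have nN: "n \<in> N" using pN[OF bN] by (simp add: n_def)
  have "n [^] m = inv ((b [^] u) [^] m)" unfolding n_def using pN[OF bN] by (simp add: nat_pow_inv)
  then have nm: "n [^] m = inv b" using root[OF bN] by simp
  have nm': "inv n [^] m = b" using nm nN bN by (simp add: nat_pow_inv)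
  show thesis
  proof
    show "n \<in> N" by fact
    fix l assume l: "l \<in> H"
    have G: "l \<in> carrier G" "n \<in> carrier G" "b \<in> carrier G" using l nN bN by auto
    have lX: "l \<in> X" "n \<in> X" "inv n \<in> X" using l H nN NX by auto
    have 1: "c (l \<otimes> inv n) = b"
      using cmult[OF lX(1,3)] cpow[of "inv n"] nN nm' b[OF l] by simp
    have "c (n \<otimes> (l \<otimes> inv n)) = (n \<otimes> b \<otimes> inv n) \<otimes> inv b"
      using cmult[of n "l \<otimes> inv n"] lX 1 cpow[OF nN] nm by simp
    also have "n \<otimes> b \<otimes> inv n = b" using ab[OF nN bN] G by (simp add: group_simps)
    finally show "c (n \<otimes> l \<otimes> inv n) = \<one>" using G by (simp add: m_assoc)
  qed
qed

lemma conj_image_subgroup: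
  assumes H: "subgroup H G" and g: "g \<in> carrier G"
  shows "subgroup ((\<lambda>h. g \<otimes> h \<otimes> inv g) ` H) G"
    and "card ((\<lambda>h. g \<otimes> h \<otimes> inv g) ` H) = card H"
proof -
  interpret H: subgroup H G by fact
  show "subgroup ((\<lambda>h. g \<otimes> h \<otimes> inv g) ` H) G"
  proof (rule subgroupI)
    show "(\<lambda>h. g \<otimes> h \<otimes> inv g) ` H \<subseteq> carrier G" using g by auto
    show "(\<lambda>h. g \<otimes> h \<otimes> inv g) ` H \<noteq> {}" using H.one_closed by blast
  next
    fix a assume "a \<in> (\<lambda>h. g \<otimes> h \<otimes> inv g) ` H"
    then obtain h where h: "h \<in> H" "a = g \<otimes> h \<otimes> inv g" by auto
    then have "inv a = g \<otimes> inv h \<otimes> inv g" using g by (simp add: group_simps)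
    with h show "inv a \<in> (\<lambda>h. g \<otimes> h \<otimes> inv g) ` H" by auto
  next
    fix a b assume "a \<in> (\<lambda>h. g \<otimes> h \<otimes> inv g) ` H" "b \<in> (\<lambda>h. g \<otimes> h \<otimes> inv g) ` H"
    then obtain h k where h: "h \<in> H" "a = g \<otimes> h \<otimes> inv g" "k \<in> H" "b = g \<otimes> k \<otimes> inv g" by auto
    then have "a \<otimes> b = g \<otimes> (h \<otimes> k) \<otimes> inv g" using g by (simp add: group_simps)
    with h show "a \<otimes> b \<in> (\<lambda>h. g \<otimes> h \<otimes> inv g) ` H" by auto
  qed
  show "card ((\<lambda>h. g \<otimes> h \<otimes> inv g) ` H) = card H"
    using g by (intro card_image inj_onI) simp
qed

text \<open>The complement is the zero set of the crossed homomorphism \<open>c\<close>. On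
  \<open>N\<close> it is the m-th power map, a bijection by coprimality, so each coset of
  \<open>N\<close> in \<open>X\<close> meets the zero set exactly once. The last clause feeds the
  Frattini argument: a G-conjugate of \<open>H\<close> is again a subgroup of \<open>X\<close> of
  order \<open>m\<close>, hence conjugate under \<open>N\<close> to a subgroup of the zero
  set.\<close>

lemma schur_zassenhaus_abelian:
  assumes fin: "finite (carrier G)" and N: "N \<lhd> G"
    and ab: "\<And>x y. x \<in> N \<Longrightarrow> y \<in> N \<Longrightarrow> x \<otimes> y = y \<otimes> x"
    and X: "X \<lhd> G" and NX: "N \<subseteq> X" and card: "card X = card N * m"
    and cop: "coprime m (card N)"
  obtains H where "subgroup H G" "H \<subseteq> X" "card H = m" "N <#> H = X"
    and "\<And>g. g \<in> carrier G \<Longrightarrow> \<exists>n\<in>N. \<forall>h\<in>H. n \<otimes> (g \<otimes> h \<otimes> inv g) \<otimes> inv n \<in> H"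
proof -
  interpret N: normal N G by fact
  interpret X: normal X G by fact
  interpret A: comm_group "G\<lparr>carrier := N\<rparr>"
    using N.subgroup_axioms ab by (rule abelian_subgroup_comm_group)
  have m0: "m \<noteq> 0" using card_subgroup_pos[OF fin X.subgroup_axioms] card by (cases m) auto
  obtain u where root: "\<And>x. x \<in> N \<Longrightarrow> (x [^] (u::nat)) [^] m = x"
    using coprime_pow_root[OF N.subgroup_axioms m0 cop] by blast
  have pN: "x [^] (k::nat) \<in> N" if "x \<in> N" for x k
    using A.nat_pow_closed[of x k] that by (simp add: nat_pow_consistent[symmetric])
  obtain c where cN: "\<And>x. x \<in> X \<Longrightarrow> c x \<in> N"
    and cmult: "\<And>x y. x \<in> X \<Longrightarrow> y \<in> X \<Longrightarrow> c (x \<otimes> y) = (x \<otimes> c y \<otimes> inv x) \<otimes> c x"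
    and cpow: "\<And>n. n \<in> N \<Longrightarrow> c n = n [^] m"
    using exists_crossed_hom[OF fin N ab X.subgroup_axioms NX card] by blast
  define H where "H = {x \<in> X. c x = \<one>}"
  have HX: "H \<subseteq> X" by (auto simp: H_def)
  have c1: "c \<one> = \<one>" using cpow[of \<one>] by simp
  have H: "subgroup H G"
  proof (rule subgroupI)
    show "H \<subseteq> carrier G" using HX X.subset by auto
    have "\<one> \<in> H" using c1 by (simp add: H_def)
    then show "H \<noteq> {}" by blast
  next
    fix a assume "a \<in> H"
    then have a: "a \<in> X" "c a = \<one>" by (auto simp: H_def)
    have aG: "a \<in> carrier G" "c (inv a) \<in> carrier G" using a cN[of "inv a"] by auto
    have e: "a \<otimes> c (inv a) \<otimes> inv a = \<one>" using cmult[of a "inv a"] a c1 aG by auto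
    have "c (inv a) = inv a \<otimes> (a \<otimes> c (inv a) \<otimes> inv a) \<otimes> a" using aG by (simp add: group_simps)
    also have "\<dots> = \<one>" unfolding e using aG by simp
    finally have "c (inv a) = \<one>" .
    then show "inv a \<in> H" using a by (simp add: H_def)
  next
    fix a b assume "a \<in> H" "b \<in> H"
    then show "a \<otimes> b \<in> H" using cmult[of a b] by (auto simp: H_def)
  qed
  have NH: "N <#> H = X"
  proof
    show "N <#> H \<subseteq> X" using NX HX by (auto simp: set_mult_def)
    show "X \<subseteq> N <#> H"
    proof
      fix x assume x: "x \<in> X"
      \<comment> \<open>\<open>n\<close> solves \<open>n [^] m = inv (c x)\<close>, the equation
        under which \<open>c (n \<otimes> x)\<close> vanishes.\<close>
      define n where "n = (inv (c x)) [^] u"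
      have cx: "c x \<in> N" using cN x by simp
      have n: "n \<in> N" "n [^] m = inv (c x)" using root[of "inv (c x)"] pN cx by (auto simp: n_def)
      have "c (n \<otimes> x) = (n \<otimes> c x \<otimes> inv n) \<otimes> inv (c x)"
        using cmult[of n x] cpow[of n] n x NX by auto
      also have "n \<otimes> c x \<otimes> inv n = c x" using ab[OF n(1) cx] n(1) cx by (simp add: group_simps)
      finally have "n \<otimes> x \<in> H" using n x cx NX by (auto simp: H_def)
      moreover have "x = inv n \<otimes> (n \<otimes> x)" using n x by (simp add: group_simps)
      moreover have "inv n \<in> N" using n(1) by simp
      ultimately show "x \<in> N <#> H" unfolding set_mult_def by blast
    qed
  qed
  have "N \<inter> H = {\<one>}"
  proof
    show "N \<inter> H \<subseteq> {\<one>}"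
    proof
      fix x assume "x \<in> N \<inter> H"
      then have x: "x \<in> N" "x [^] m = \<one>" using cpow by (auto simp: H_def)
      have "x = (x [^] m) [^] u" using root[OF x(1)] x(1) by (simp add: nat_pow_pow mult.commute)
      then show "x \<in> {\<one>}" using x by simp
    qed
    show "{\<one>} \<subseteq> N \<inter> H" using subgroup.one_closed[OF H] by auto
  qed
  then have cH: "card H = m"
    using card_set_mult[OF N.subgroup_axioms H] NH card card_subgroup_pos[OF fin N.subgroup_axioms] by simp
  show thesis
  proof
    show "subgroup H G" "H \<subseteq> X" "card H = m" "N <#> H = X" by fact+
    fix g assume g: "g \<in> carrier G"
    let ?K = "(\<lambda>h. g \<otimes> h \<otimes> inv g) ` H"
    have KX: "?K \<subseteq> X" using HX X.inv_op_closed2 g by auto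
    obtain n where n: "n \<in> N" "\<And>h. h \<in> ?K \<Longrightarrow> c (n \<otimes> h \<otimes> inv n) = \<one>"
      using crossed_hom_conj[OF fin N ab X.subgroup_axioms NX cN cmult cpow cop conj_image_subgroup(1)[OF H g] KX]
        conj_image_subgroup(2)[OF H g] cH by metis
    have "n \<otimes> h \<otimes> inv n \<in> X" if "h \<in> ?K" for h using that KX n(1) NX by auto
    with n show "\<exists>n\<in>N. \<forall>h\<in>H. n \<otimes> (g \<otimes> h \<otimes> inv g) \<otimes> inv n \<in> H"
      by (intro bexI[of _ n]) (auto simp: H_def)
  qed
qed

section \<open>Maximal subgroups and the Frattini argument\<close>

lemma exists_maximal_subgroup:
  assumes fin: "finite (carrier G)" and U: "subgroup U G" "U \<noteq> carrier G"
  obtains M where "maximal_subgroup M G" "U \<subseteq> M"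
proof -
  let ?S = "{M. subgroup M G \<and> M \<noteq> carrier G}"
  have "?S \<subseteq> Pow (carrier G)" by (metis (no_types, lifting) CollectD PowI subgroup.subset subsetI)
  then have "finite ?S" using fin by (meson finite_Pow_iff finite_subset)
  from finite_has_maximal2[OF this, of U] U
  obtain M where M: "subgroup M G" "M \<noteq> carrier G" "U \<subseteq> M"
    and max: "\<forall>K\<in>?S. M \<subseteq> K \<longrightarrow> M = K" by auto
  have "maximal_subgroup M G" unfolding maximal_subgroup_def using M(1,2) max by auto
  then show thesis using M(3) by (rule that)
qed

text \<open>The normalizer \<open>U\<close> of \<open>H\<close> is proper because \<open>H\<close>
  is not normal, and \<open>frat\<close> gives \<open>G = N U\<close>. Any maximal \<open>M\<close>
  above \<open>U\<close> therefore satisfies \<open>G = N M\<close>. It meets \<open>N\<close> in a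
  normal subgroup of \<open>G\<close>, and the intersection cannot be all of \<open>N\<close>, since
  \<open>M\<close> would then be \<open>G\<close>.\<close>

lemma exists_complement_maximal:
  assumes fin: "finite (carrier G)" and N: "N \<lhd> G"
    and ab: "\<And>x y. x \<in> N \<Longrightarrow> y \<in> N \<Longrightarrow> x \<otimes> y = y \<otimes> x"
    and min: "\<And>L. L \<lhd> G \<Longrightarrow> L \<subseteq> N \<Longrightarrow> L = {\<one>} \<or> L = N"
    and H: "subgroup H G" "\<not> H \<lhd> G"
    and frat: "\<And>g. g \<in> carrier G \<Longrightarrow> \<exists>n\<in>N. \<forall>h\<in>H. n \<otimes> (g \<otimes> h \<otimes> inv g) \<otimes> inv n \<in> H"
  obtains M where "maximal_subgroup M G" "N \<inter> M = {\<one>}" "N <#> M = carrier G"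
proof -
  interpret N: normal N G by fact
  interpret H: subgroup H G by fact
  define U where "U = {g \<in> carrier G. (\<lambda>h. g \<otimes> h \<otimes> inv g) ` H = H}"
  have U: "subgroup U G"
  proof (rule subgroupI)
    show "U \<subseteq> carrier G" by (auto simp: U_def)
    have "(\<lambda>h. \<one> \<otimes> h \<otimes> inv \<one>) ` H = (\<lambda>h. h) ` H" by (intro image_cong) auto
    then show "U \<noteq> {}" by (auto simp: U_def)
  next
    fix a assume a: "a \<in> U"
    have "(\<lambda>h. inv a \<otimes> h \<otimes> inv (inv a)) ` (\<lambda>h. a \<otimes> h \<otimes> inv a) ` H = (\<lambda>h. h) ` H"
      unfolding image_image using a by (intro image_cong) (auto simp: U_def group_simps)
    then show "inv a \<in> U" using a by (simp add: U_def)
  next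
    fix a b assume a: "a \<in> U" "b \<in> U"
    have "(\<lambda>h. a \<otimes> h \<otimes> inv a) ` (\<lambda>h. b \<otimes> h \<otimes> inv b) ` H = (\<lambda>h. (a \<otimes> b) \<otimes> h \<otimes> inv (a \<otimes> b)) ` H"
      unfolding image_image using a by (intro image_cong) (auto simp: U_def group_simps)
    then show "a \<otimes> b \<in> U" using a by (simp add: U_def)
  qed
  have UG: "U \<noteq> carrier G"
  proof
    assume "U = carrier G"
    then have "H \<lhd> G" using H(1) by (subst normal_inv_iff) (auto simp: U_def)
    with H(2) show False by simp
  qed
  have finH: "finite H" using fin H.subset finite_subset by blast
  have fac: "\<exists>n\<in>N. \<exists>u\<in>U. g = n \<otimes> u" if g: "g \<in> carrier G" for g
  proof -
    obtain n where n: "n \<in> N" "\<forall>h\<in>H. n \<otimes> (g \<otimes> h \<otimes> inv g) \<otimes> inv n \<in> H" using frat[OF g] by auto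
    have "(n \<otimes> g) \<otimes> h \<otimes> inv (n \<otimes> g) \<in> H" if "h \<in> H" for h
      using n that g by (auto simp: group_simps)
    then have "(\<lambda>h. (n \<otimes> g) \<otimes> h \<otimes> inv (n \<otimes> g)) ` H = H"
      using finH n(1) g by (intro endo_inj_surj inj_onI) auto
    then have "n \<otimes> g \<in> U" using n(1) g by (auto simp: U_def)
    moreover have "g = inv n \<otimes> (n \<otimes> g)" using n(1) g by (simp add: group_simps)
    ultimately show ?thesis using n(1) by blast
  qed
  obtain M where M: "maximal_subgroup M G" "U \<subseteq> M" using exists_maximal_subgroup[OF fin U UG] .
  have Ms: "subgroup M G" and MG: "M \<noteq> carrier G" using M(1) by (auto simp: maximal_subgroup_def)
  interpret M: subgroup M G by fact
  have NM: "N <#> M = carrier G"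
  proof
    show "N <#> M \<subseteq> carrier G" by (auto simp: set_mult_def)
    show "carrier G \<subseteq> N <#> M" using fac M(2) unfolding set_mult_def by blast
  qed
  have "N \<inter> M \<lhd> G"
  proof (subst normal_inv_iff, intro conjI ballI)
    show "subgroup (N \<inter> M) G" using N.subgroup_axioms Ms by (rule subgroups_Inter_pair)
    fix g x assume g: "g \<in> carrier G" and x: "x \<in> N \<inter> M"
    \<comment> \<open>\<open>u\<close> lies in \<open>M\<close> and so normalizes the intersection,
      while \<open>n\<close> centralizes it because \<open>N\<close> is abelian.\<close>
    obtain n u where nu: "n \<in> N" "u \<in> U" "g = n \<otimes> u" using fac[OF g] by auto
    have uM: "u \<in> M" using nu M by auto
    have ux: "u \<otimes> x \<otimes> inv u \<in> N" using x uM N.inv_op_closed2 by auto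
    have "g \<otimes> x \<otimes> inv g = n \<otimes> (u \<otimes> x \<otimes> inv u) \<otimes> inv n"
      using nu uM x by (simp add: group_simps)
    also have "\<dots> = u \<otimes> x \<otimes> inv u" using ab[OF nu(1) ux] nu uM x by (simp add: m_assoc)
    finally show "g \<otimes> x \<otimes> inv g \<in> N \<inter> M" using ux uM x by auto
  qed
  then have "N \<inter> M = {\<one>} \<or> N \<inter> M = N" using min by simp
  moreover have "N \<inter> M \<noteq> N"
  proof
    assume "N \<inter> M = N"
    then have "N <#> M \<subseteq> M" by (auto simp: set_mult_def)
    with NM MG M.subset show False by auto
  qed
  ultimately show thesis using M(1) NM that by blast
qed

end

section \<open>Irreducible matrix representations\<close>

lemma subspace_iff:
  "VectorSpace.subspace class_ring W (module_vec TYPE(complex) n) \<longleftrightarrow>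
     W \<subseteq> carrier_vec n \<and> 0\<^sub>v n \<in> W \<and> (\<forall>v\<in>W. \<forall>w\<in>W. v + w \<in> W) \<and> (\<forall>c. \<forall>v\<in>W. c \<cdot>\<^sub>v v \<in> W)"
  using vec_vs[of n, where 'a = complex] vec_module[of n, where 'a = complex]
  unfolding VectorSpace.subspace_def submodule_def module_vec_simps
  by (auto simp: class_ring_simps)

lemma representationD:
  assumes "group G" "representation G n \<rho>"
  shows "g \<in> carrier G \<Longrightarrow> \<rho> g \<in> carrier_mat n n"
    and "g \<in> carrier G \<Longrightarrow> h \<in> carrier G \<Longrightarrow> \<rho> (g \<otimes>\<^bsub>G\<^esub> h) = \<rho> g * \<rho> h"
    and "\<rho> \<one>\<^bsub>G\<^esub> = 1\<^sub>m n"
proof -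
  interpret G: group G by fact
  interpret R: ring "ring_mat TYPE(complex) n ()" by (rule ring_mat)
  have h: "\<rho> \<in> hom G (units_of (ring_mat TYPE(complex) n ()))"
    using assms(2) by (simp add: representation_def)
  have U: "\<rho> g \<in> Units (ring_mat TYPE(complex) n ())" if "g \<in> carrier G" for g
    using hom_in_carrier[OF h that] by (simp add: units_of_carrier)
  then show "g \<in> carrier G \<Longrightarrow> \<rho> g \<in> carrier_mat n n"
    by (auto simp: Units_def ring_mat_simps)
  show "g \<in> carrier G \<Longrightarrow> h \<in> carrier G \<Longrightarrow> \<rho> (g \<otimes>\<^bsub>G\<^esub> h) = \<rho> g * \<rho> h"
    using hom_mult[OF h] by (simp add: units_of_mult ring_mat_simps)
  have "\<rho> \<one>\<^bsub>G\<^esub> = \<one>\<^bsub>units_of (ring_mat TYPE(complex) n ())\<^esub>"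
    using hom_one[OF h G.is_group R.units_group] .
  then show "\<rho> \<one>\<^bsub>G\<^esub> = 1\<^sub>m n" by (simp add: units_of_one ring_mat_simps)
qed

lemma representationI:
  assumes "group G"
    and car: "\<And>g. g \<in> carrier G \<Longrightarrow> \<rho> g \<in> carrier_mat n n"
    and mult: "\<And>g h. g \<in> carrier G \<Longrightarrow> h \<in> carrier G \<Longrightarrow> \<rho> (g \<otimes>\<^bsub>G\<^esub> h) = \<rho> g * \<rho> h"
    and one: "\<rho> \<one>\<^bsub>G\<^esub> = 1\<^sub>m n"
  shows "representation G n \<rho>"
  unfolding representation_def
proof (rule homI)
  interpret G: group G by fact
  fix g h assume g: "g \<in> carrier G"
  have "\<rho> (inv\<^bsub>G\<^esub> g) * \<rho> g = 1\<^sub>m n" "\<rho> g * \<rho> (inv\<^bsub>G\<^esub> g) = 1\<^sub>m n"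
    using mult[of "inv\<^bsub>G\<^esub> g" g] mult[of g "inv\<^bsub>G\<^esub> g"] one g by simp_all
  then show "\<rho> g \<in> carrier (units_of (ring_mat TYPE(complex) n ()))"
    using car g by (auto simp: units_of_carrier Units_def ring_mat_simps)
  assume "h \<in> carrier G"
  with g show "\<rho> (g \<otimes>\<^bsub>G\<^esub> h) = \<rho> g \<otimes>\<^bsub>units_of (ring_mat TYPE(complex) n ())\<^esub> \<rho> h"
    using mult by (simp add: units_of_mult ring_mat_simps)
qed

section \<open>Matrix entries and eigenvalues of integer matrices\<close>

lemma index_mult_mat_sum:
  assumes "A \<in> carrier_mat n n" "B \<in> carrier_mat n n" "i < n" "j < n"
  shows "(A * B) $$ (i, j) = (\<Sum>k<n. A $$ (i, k) * B $$ (k, j))"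
  using assms by (simp add: scalar_prod_def atLeast0LessThan)

lemma index_mult_mat_vec_sum:
  assumes "A \<in> carrier_mat n n" "v \<in> carrier_vec n" "i < n"
  shows "(A *\<^sub>v v) $ i = (\<Sum>k<n. A $$ (i, k) * v $ k)"
  using assms by (simp add: scalar_prod_def atLeast0LessThan)

lemma eq_mat_by_vec:
  assumes A: "A \<in> carrier_mat n n" and B: "B \<in> carrier_mat n n"
    and eq: "\<And>v :: 'a :: comm_ring_1 vec. v \<in> carrier_vec n \<Longrightarrow> A *\<^sub>v v = B *\<^sub>v v"
  shows "A = B"
proof (rule eq_matI)
  fix i j assume ij: "i < dim_row B" "j < dim_col B"
  have "(C *\<^sub>v unit_vec n j) $ i = C $$ (i, j)" if C: "C \<in> carrier_mat n n" for C :: "'a mat"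
  proof -
    have "(C *\<^sub>v unit_vec n j) $ i = (\<Sum>k<n. C $$ (i, k) * (if k = j then 1 else 0))"
      using C B ij by (subst index_mult_mat_vec_sum[of _ n]) auto
    also have "\<dots> = (\<Sum>k<n. if k = j then C $$ (i, k) else 0)" by (rule sum.cong) auto
    finally show ?thesis using B ij by simp
  qed
  from this[OF A] this[OF B] show "A $$ (i, j) = B $$ (i, j)" by (simp add: eq)
qed (use A B in auto)

text \<open>\<open>c\<close> is a root of the characteristic polynomial of an integer matrix, which
  is monic with integer coefficients. Allowing any finite index set lets \<open>G \<times> G\<close>
  index the rows later on.\<close>

lemma algebraic_int_eigen:
  fixes v :: "'s \<Rightarrow> complex" and a :: "'s \<Rightarrow> 's \<Rightarrow> int"
  assumes fin: "finite S" and eq: "\<And>s. s \<in> S \<Longrightarrow> (\<Sum>t\<in>S. of_int (a s t) * v t) = c * v s"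
    and s0: "s0 \<in> S" "v s0 \<noteq> 0"
  shows "algebraic_int c"
proof -
  define N where "N = card S"
  obtain e where e: "bij_betw e {..<N} S"
    using ex_bij_betw_nat_finite[OF fin] by (auto simp: N_def atLeast0LessThan)
  define A where "A = mat N N (\<lambda>(i, j). a (e i) (e j))"
  have A: "A \<in> carrier_mat N N" by (simp add: A_def)
  define B :: "complex mat" where "B = map_mat of_int A"
  have B: "B \<in> carrier_mat N N" using A by (simp add: B_def)
  define w where "w = vec N (\<lambda>i. v (e i))"
  have w: "w \<in> carrier_vec N" by (simp add: w_def)
  have eS: "e i \<in> S" if "i < N" for i using e that by (auto simp: bij_betw_def)
  have "B *\<^sub>v w = c \<cdot>\<^sub>v w"
  proof (rule eq_vecI)
    fix i assume "i < dim_vec (c \<cdot>\<^sub>v w)"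
    then have i: "i < N" by (simp add: w_def)
    have "(B *\<^sub>v w) $ i = (\<Sum>k<N. of_int (a (e i) (e k)) * v (e k))"
      using i by (subst index_mult_mat_vec_sum[OF B w]) (auto simp: B_def A_def w_def)
    also have "\<dots> = (\<Sum>t\<in>S. of_int (a (e i) t) * v t)"
      by (rule sum.reindex_bij_betw[OF e])
    also have "\<dots> = c * v (e i)" by (rule eq[OF eS[OF i]])
    finally show "(B *\<^sub>v w) $ i = (c \<cdot>\<^sub>v w) $ i" using i by (simp add: w_def)
  qed (use B in \<open>auto simp: w_def\<close>)
  moreover have "w \<noteq> 0\<^sub>v N"
  proof
    assume w0: "w = 0\<^sub>v N"
    obtain i where i: "i < N" "e i = s0" using e s0(1) by (auto simp: bij_betw_def)
    then have "w $ i = v s0" by (simp add: w_def)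
    with w0 i s0(2) show False by simp
  qed
  ultimately have "eigenvalue B c" using B w unfolding eigenvalue_def eigenvector_def by auto
  then have "poly (char_poly B) c = 0" using eigenvalue_root_char_poly[OF B] by simp
  moreover have "char_poly B = map_poly of_int (char_poly A)"
    unfolding B_def by (rule of_int_hom.char_poly_hom[OF A])
  moreover have "lead_coeff (char_poly A) = 1" using degree_monic_char_poly[OF A] by simp
  ultimately show ?thesis by (auto simp: algebraic_int_altdef_ipoly)
qed

section \<open>Schur's lemma, orthogonality relations and degrees\<close>

locale irreducible_rep = group G for G :: "('a, 'b) monoid_scheme" (structure) +
  fixes n :: nat and \<rho> :: "'a \<Rightarrow> complex mat"
  assumes fin: "finite (carrier G)" and irr: "irreducible_representation G n \<rho>"
begin

lemma n_pos: "n > 0" using irr by (simp add: irreducible_representation_def)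

lemma rep: "representation G n \<rho>" using irr by (simp add: irreducible_representation_def)

lemmas rho_carrier = representationD(1)[OF is_group rep]
lemmas rho_mult = representationD(2)[OF is_group rep]
lemmas rho_one = representationD(3)[OF is_group rep]

lemma invariant_subspace:
  assumes "W \<subseteq> carrier_vec n" "0\<^sub>v n \<in> W" "\<And>v w. v \<in> W \<Longrightarrow> w \<in> W \<Longrightarrow> v + w \<in> W"
    "\<And>c v. v \<in> W \<Longrightarrow> c \<cdot>\<^sub>v v \<in> W" "\<And>g w. g \<in> carrier G \<Longrightarrow> w \<in> W \<Longrightarrow> \<rho> g *\<^sub>v w \<in> W"
    and "w \<in> W" "w \<noteq> 0\<^sub>v n"
  shows "W = carrier_vec n"
proof -
  have "VectorSpace.subspace class_ring W (module_vec TYPE(complex) n)"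
    unfolding subspace_iff using assms(1-4) by simp
  then have "W = {0\<^sub>v n} \<or> W = carrier_vec n"
    using irr assms(5) unfolding irreducible_representation_def by simp
  with assms(6,7) show ?thesis by auto
qed

text \<open>Since n > 0, \<open>A\<close> has a complex eigenvalue; its eigenspace is nonzero and,
  as \<open>A\<close> commutes with the representation, invariant, so it is the whole space.\<close>

lemma schur:
  assumes A: "A \<in> carrier_mat n n" and comm: "\<And>g. g \<in> carrier G \<Longrightarrow> A * \<rho> g = \<rho> g * A"
  obtains c where "A = c \<cdot>\<^sub>m 1\<^sub>m n"
proof -
  obtain c v where v: "v \<in> carrier_vec n" "v \<noteq> 0\<^sub>v n" "A *\<^sub>v v = c \<cdot>\<^sub>v v"
    using spectrum_non_empty[OF A n_pos] A by (auto simp: spectrum_def eigenvalue_def eigenvector_def)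
  define W where "W = {w \<in> carrier_vec n. A *\<^sub>v w = c \<cdot>\<^sub>v w}"
  have "W = carrier_vec n"
  proof (rule invariant_subspace)
    show "W \<subseteq> carrier_vec n" by (auto simp: W_def)
    show "0\<^sub>v n \<in> W" using A by (auto simp: W_def)
    show "x + y \<in> W" if "x \<in> W" "y \<in> W" for x y
      using that A by (auto simp: W_def mult_add_distrib_mat_vec smult_add_distrib_vec)
    show "d \<cdot>\<^sub>v x \<in> W" if "x \<in> W" for d x
      using that A by (auto simp: W_def mult_mat_vec smult_smult_assoc mult.commute)
    show "\<rho> g *\<^sub>v w \<in> W" if g: "g \<in> carrier G" and w: "w \<in> W" for g w
    proof -
      have wc: "w \<in> carrier_vec n" using w by (simp add: W_def)
      have "A *\<^sub>v (\<rho> g *\<^sub>v w) = (A * \<rho> g) *\<^sub>v w"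
        using A rho_carrier[OF g] wc by (simp add: assoc_mult_mat_vec)
      also have "\<dots> = \<rho> g *\<^sub>v (A *\<^sub>v w)"
        using A rho_carrier[OF g] wc by (simp add: comm[OF g] assoc_mult_mat_vec)
      also have "\<dots> = c \<cdot>\<^sub>v (\<rho> g *\<^sub>v w)"
        using w rho_carrier[OF g] by (simp add: W_def mult_mat_vec)
      finally show ?thesis using rho_carrier[OF g] wc by (simp add: W_def)
    qed
    show "v \<in> W" "v \<noteq> 0\<^sub>v n" using v by (auto simp: W_def)
  qed
  moreover have "(c \<cdot>\<^sub>m 1\<^sub>m n) *\<^sub>v w = c \<cdot>\<^sub>v w" if w: "w \<in> carrier_vec n" for w
  proof (rule eq_vecI)
    fix i assume "i < dim_vec (c \<cdot>\<^sub>v w)"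
    then have i: "i < n" using w by simp
    have "((c \<cdot>\<^sub>m 1\<^sub>m n) *\<^sub>v w) $ i = (\<Sum>k<n. (c \<cdot>\<^sub>m 1\<^sub>m n) $$ (i, k) * w $ k)"
      using i w by (subst index_mult_mat_vec_sum[of _ n]) auto
    also have "\<dots> = (\<Sum>k<n. if k = i then c * w $ k else 0)" using i by (intro sum.cong) auto
    finally show "((c \<cdot>\<^sub>m 1\<^sub>m n) *\<^sub>v w) $ i = (c \<cdot>\<^sub>v w) $ i" using i w by simp
  qed (use w in auto)
  ultimately have "A *\<^sub>v w = (c \<cdot>\<^sub>m 1\<^sub>m n) *\<^sub>v w" if "w \<in> carrier_vec n" for w
    using that by (auto simp: W_def)
  then have "A = c \<cdot>\<^sub>m 1\<^sub>m n" using A by (intro eq_mat_by_vec) auto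
  then show thesis by (rule that)
qed

definition entry :: "'a \<Rightarrow> nat \<Rightarrow> nat \<Rightarrow> complex" where
  "entry g i j = \<rho> g $$ (i, j)"

lemma entry_mult:
  "g \<in> carrier G \<Longrightarrow> h \<in> carrier G \<Longrightarrow> i < n \<Longrightarrow> j < n \<Longrightarrow>
     entry (g \<otimes> h) i j = (\<Sum>k<n. entry g i k * entry h k j)"
  unfolding entry_def by (simp only: rho_mult index_mult_mat_sum[OF rho_carrier rho_carrier])

lemma entry_one: "i < n \<Longrightarrow> j < n \<Longrightarrow> entry \<one> i j = (if i = j then 1 else 0)"
  by (simp add: entry_def rho_one)

lemma character_eq: "g \<in> carrier G \<Longrightarrow> character G \<rho> g = (\<Sum>i<n. entry g i i)"
  using rho_carrier[of g] by (simp add: character_def mat_trace_def entry_def)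

lemma character_one: "character G \<rho> \<one> = of_nat n"
  by (simp add: character_eq entry_one)

lemma character_conj:
  assumes "g \<in> carrier G" "x \<in> carrier G"
  shows "character G \<rho> (x \<otimes> g \<otimes> inv x) = character G \<rho> g"
proof -
  have comm: "character G \<rho> (a \<otimes> b) = character G \<rho> (b \<otimes> a)" if "a \<in> carrier G" "b \<in> carrier G" for a b
  proof -
    have "character G \<rho> (a \<otimes> b) = (\<Sum>i<n. \<Sum>k<n. entry a i k * entry b k i)"
      using that by (simp add: character_eq entry_mult)
    also have "\<dots> = (\<Sum>k<n. \<Sum>i<n. entry a i k * entry b k i)" by (rule sum.swap)
    also have "\<dots> = character G \<rho> (b \<otimes> a)"
      using that by (simp add: character_eq entry_mult mult.commute)
    finally show ?thesis .
  qed
  have "character G \<rho> (x \<otimes> g \<otimes> inv x) = character G \<rho> (inv x \<otimes> (x \<otimes> g))"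
    using assms by (intro comm) auto
  then show ?thesis using assms by (simp add: group_simps)
qed

lemma sum_left_translate:
  assumes "h \<in> carrier G"
  shows "(\<Sum>g\<in>carrier G. f (h \<otimes> g)) = (\<Sum>g\<in>carrier G. f g)"
  by (rule sum.reindex_bij_witness[of _ "\<lambda>g. inv h \<otimes> g" "\<lambda>g. h \<otimes> g"])
    (use assms in \<open>auto simp: group_simps\<close>)

text \<open>For fixed \<open>j\<close> and \<open>k\<close> the sums form the matrix of the average
  \<Sum>g. \<rho>(g) E_jk \<rho>(g)^-1 with the matrix unit E_jk. Substituting
  \<open>h \<otimes> g\<close> for \<open>g\<close> shows that it commutes with the representation,
  so by Schur it is a scalar.\<close>

lemma entry_orthogonality:
  assumes ij: "i < n" "j < n" "k < n" "l < n"
  shows "(\<Sum>g\<in>carrier G. entry g i j * entry (inv g) k l)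
    = (if i = l \<and> j = k then of_nat (card (carrier G)) / of_nat n else 0)"
proof -
  define A where "A = mat n n (\<lambda>(i, l). \<Sum>g\<in>carrier G. entry g i j * entry (inv g) k l)"
  have A: "A \<in> carrier_mat n n" by (simp add: A_def)
  have "A * \<rho> h = \<rho> h * A" if h: "h \<in> carrier G" for h
  proof (rule eq_matI)
    fix p q assume "p < dim_row (\<rho> h * A)" "q < dim_col (\<rho> h * A)"
    then have pq: "p < n" "q < n" using A rho_carrier[OF h] by auto
    have "(A * \<rho> h) $$ (p, q) = (\<Sum>m<n. (\<Sum>g\<in>carrier G. entry g p j * entry (inv g) k m) * entry h m q)"
      using pq by (subst index_mult_mat_sum[OF A rho_carrier[OF h]]) (auto simp: A_def entry_def)
    also have "\<dots> = (\<Sum>g\<in>carrier G. \<Sum>m<n. entry g p j * entry (inv g) k m * entry h m q)"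
      unfolding sum_distrib_right by (rule sum.swap)
    also have "\<dots> = (\<Sum>g\<in>carrier G. entry g p j * entry (inv g \<otimes> h) k q)"
      using pq ij h by (intro sum.cong) (simp_all add: entry_mult sum_distrib_left mult.assoc)
    also have "\<dots> = (\<Sum>g\<in>carrier G. entry (h \<otimes> g) p j * entry (inv (h \<otimes> g) \<otimes> h) k q)"
      by (rule sum_left_translate[OF h, symmetric])
    also have "\<dots> = (\<Sum>g\<in>carrier G. \<Sum>m<n. entry h p m * (entry g m j * entry (inv g) k q))"
      using pq ij h by (intro sum.cong) (simp_all add: entry_mult sum_distrib_right group_simps mult.assoc)
    also have "\<dots> = (\<Sum>m<n. entry h p m * (\<Sum>g\<in>carrier G. entry g m j * entry (inv g) k q))"
      unfolding sum_distrib_left by (rule sum.swap)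
    also have "\<dots> = (\<rho> h * A) $$ (p, q)"
      using pq by (subst index_mult_mat_sum[OF rho_carrier[OF h] A]) (auto simp: A_def entry_def)
    finally show "(A * \<rho> h) $$ (p, q) = (\<rho> h * A) $$ (p, q)" .
  qed (use A rho_carrier[OF h] in auto)
  then obtain c where c: "A = c \<cdot>\<^sub>m 1\<^sub>m n" using schur[OF A] by blast
  have Aent: "A $$ (p, q) = (if p = q then c else 0)" if "p < n" "q < n" for p q
    using that by (simp add: c)
  \<comment> \<open>The trace determines the scalar: each summand contributes the trace of E_jk,
    which is 1 for j = k and 0 otherwise.\<close>
  have "of_nat n * c = (\<Sum>p<n. A $$ (p, p))" by (simp add: Aent)
  also have "\<dots> = (\<Sum>g\<in>carrier G. \<Sum>p<n. entry (inv g) k p * entry g p j)"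
    by (subst sum.swap) (simp add: A_def mult.commute)
  also have "\<dots> = (\<Sum>g\<in>carrier G. entry (inv g \<otimes> g) k j)"
    using ij by (intro sum.cong) (simp_all only: entry_mult inv_closed)
  also have "\<dots> = (if j = k then of_nat (card (carrier G)) else 0)"
    using ij by (auto simp: entry_one)
  finally have "c = (if j = k then of_nat (card (carrier G)) / of_nat n else 0)"
    using n_pos by (auto simp: field_simps split: if_splits)
  then show ?thesis using Aent[of i l] ij by (auto simp: A_def)
qed

text \<open>By orthogonality the operator \<open>\<Sum>g. \<rho> g \<otimes> \<rho> (inv g)\<close> is \<open>|G| / n\<close> times the swap of the two
  tensor factors, and the swap fixes the \<open>(0,0)\<close> entry. Hence \<open>|G| / n\<close> is an eigenvalue of the
  integer matrix of \<open>\<Sum>g. (g, inv g)\<close> acting on \<open>G \<times> G\<close>, which avoids the usual argument that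
  character values are sums of roots of unity.\<close>

theorem degree_dvd_order: "n dvd card (carrier G)"
proof -
  define c :: complex where "c = of_nat (card (carrier G)) / of_nat n"
  define v where "v = (\<lambda>(x, y). entry x 0 0 * entry y 0 0)"
  define act where "act = (\<lambda>(x, y) g. (g \<otimes> x, inv g \<otimes> y))"
  \<comment> \<open>The matrix entry counts the group elements that carry \<open>s\<close> to
    \<open>t\<close>; applying this integer matrix to \<open>v\<close> amounts to summing
    \<open>v (act s g)\<close> over \<open>g\<close>.\<close>
  define a where "a s t = int (card {g \<in> carrier G. act s g = t})" for s t
  have n0: "0 < n" by (rule n_pos)
  have sum: "(\<Sum>g\<in>carrier G. v (act s g)) = c * v s" if s: "s \<in> carrier G \<times> carrier G" for s
  proof -
    obtain x y where xy: "s = (x, y)" "x \<in> carrier G" "y \<in> carrier G" using s by auto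
    have "(\<Sum>g\<in>carrier G. v (act s g)) =
        (\<Sum>g\<in>carrier G. \<Sum>p<n. \<Sum>q<n. entry x p 0 * entry y q 0 * (entry g 0 p * entry (inv g) 0 q))"
      using xy n0 by (intro sum.cong) (simp_all add: v_def act_def entry_mult sum_product mult_ac)
    also have "\<dots> = (\<Sum>p<n. \<Sum>q<n. \<Sum>g\<in>carrier G. entry x p 0 * entry y q 0 * (entry g 0 p * entry (inv g) 0 q))"
      by (subst sum.swap, rule sum.cong, simp, rule sum.swap)
    also have "\<dots> = (\<Sum>p<n. \<Sum>q<n. entry x p 0 * entry y q 0 * (if 0 = q \<and> p = 0 then c else 0))"
      unfolding sum_distrib_left[symmetric] c_def
      using n0 by (intro sum.cong refl) (simp add: entry_orthogonality)
    also have "\<dots> = (\<Sum>p<n. \<Sum>q<n. if q = 0 then (if p = 0 then c * entry x 0 0 * entry y 0 0 else 0) else 0)"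
      by (intro sum.cong refl) auto
    also have "\<dots> = c * v s" using n0 by (simp add: v_def xy)
    finally show ?thesis .
  qed
  have "algebraic_int c"
  proof (rule algebraic_int_eigen[of "carrier G \<times> carrier G" a v c "(\<one>, \<one>)"])
    show "finite (carrier G \<times> carrier G)" using fin by simp
    show "v (\<one>, \<one>) \<noteq> 0" using n0 by (simp add: v_def entry_one)
    fix s assume s: "s \<in> carrier G \<times> carrier G"
    have "(\<Sum>t\<in>carrier G \<times> carrier G. of_int (a s t) * v t)
        = (\<Sum>t\<in>carrier G \<times> carrier G. \<Sum>g\<in>{g \<in> carrier G. act s g = t}. v (act s g))"
      by (intro sum.cong) (auto simp: a_def)
    also have "\<dots> = (\<Sum>g\<in>carrier G. v (act s g))"
      using s fin by (intro sum.group) (auto simp: act_def)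
    finally show "(\<Sum>t\<in>carrier G \<times> carrier G. of_int (a s t) * v t) = c * v s" using sum[OF s] by simp
  qed auto
  \<comment> \<open>A rational algebraic integer is an integer, and integrality of |G| / n is the
    divisibility sought.\<close>
  moreover have "c \<in> \<rat>" by (simp add: c_def)
  ultimately have "c \<in> \<int>" by (rule rational_algebraic_int_is_int)
  then obtain z where z: "c = of_int z" by (auto elim: Ints_cases)
  then have "of_int (int (card (carrier G))) = (of_int (z * int n) :: complex)"
    using n_pos by (simp add: c_def field_simps)
  then have "int (card (carrier G)) = z * int n" by (simp only: of_int_eq_iff)
  then have "int n dvd int (card (carrier G))" by simp
  then show ?thesis by simp
qed

lemma kernel_contains_normal:
  assumes M: "subgroup M G" and N: "N \<lhd> G" "N \<subseteq> M"
    and nz: "(\<Sum>m\<in>M. character G \<rho> m) \<noteq> 0" and x: "x \<in> N"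
  shows "\<rho> x = 1\<^sub>m n"
proof -
  interpret M: subgroup M G by fact
  interpret N: normal N G by fact
  have "(\<Sum>m\<in>M. character G \<rho> m) = (\<Sum>m\<in>M. \<Sum>i<n. entry m i i)"
    by (intro sum.cong) (auto simp: character_eq)
  also have "\<dots> = (\<Sum>i<n. \<Sum>m\<in>M. entry m i i)" by (rule sum.swap)
  finally obtain j where j: "j < n" "(\<Sum>m\<in>M. entry m j j) \<noteq> 0"
    using nz by (metis (no_types, lifting) lessThan_iff sum.neutral)
  \<comment> \<open>This is column \<open>j\<close> of \<Sum>m\<in>M. \<rho>(m). The trace of that
    operator is nonzero, so some diagonal entry is; left translation within \<open>M\<close> fixes
    each of its columns.\<close>
  define w where "w = vec n (\<lambda>i. \<Sum>m\<in>M. entry m i j)"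
  have w: "w \<in> carrier_vec n" by (simp add: w_def)
  have w0: "w \<noteq> 0\<^sub>v n"
  proof
    assume "w = 0\<^sub>v n"
    then have "w $ j = 0" using j(1) by simp
    then show False using j by (simp add: w_def)
  qed
  have wfix: "\<rho> h *\<^sub>v w = w" if h: "h \<in> M" for h
  proof (rule eq_vecI)
    have hG: "h \<in> carrier G" using h by simp
    show "dim_vec (\<rho> h *\<^sub>v w) = dim_vec w" using rho_carrier[OF hG] w by simp
    fix i assume "i < dim_vec w"
    then have i: "i < n" by (simp add: w_def)
    have "(\<rho> h *\<^sub>v w) $ i = (\<Sum>k<n. \<Sum>m\<in>M. entry h i k * entry m k j)"
      using i by (subst index_mult_mat_vec_sum[OF rho_carrier[OF hG] w])
        (auto simp: w_def entry_def sum_distrib_left)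
    also have "\<dots> = (\<Sum>m\<in>M. \<Sum>k<n. entry h i k * entry m k j)" by (rule sum.swap)
    also have "\<dots> = (\<Sum>m\<in>M. entry (h \<otimes> m) i j)"
      using i j hG by (intro sum.cong) (simp_all only: entry_mult M.mem_carrier)
    also have "\<dots> = (\<Sum>m\<in>M. entry m i j)"
      by (rule sum.reindex_bij_witness[of _ "\<lambda>g. inv h \<otimes> g" "\<lambda>g. h \<otimes> g"])
        (use h hG in \<open>auto simp: group_simps\<close>)
    finally show "(\<rho> h *\<^sub>v w) $ i = w $ i" using i by (simp add: w_def)
  qed
  define W where "W = {w \<in> carrier_vec n. \<forall>x\<in>N. \<rho> x *\<^sub>v w = w}"
  have "W = carrier_vec n"
  proof (rule invariant_subspace)
    show "W \<subseteq> carrier_vec n" by (auto simp: W_def)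
    have "\<rho> x *\<^sub>v 0\<^sub>v n = 0\<^sub>v n" if "x \<in> N" for x
      using rho_carrier[of x] that by (intro eq_vecI) auto
    then show "0\<^sub>v n \<in> W" by (simp add: W_def)
    show "v + v' \<in> W" if "v \<in> W" "v' \<in> W" for v v'
      using that mult_add_distrib_mat_vec[OF rho_carrier] by (auto simp: W_def)
    show "d \<cdot>\<^sub>v v \<in> W" if "v \<in> W" for d v
      using that mult_mat_vec[OF rho_carrier] by (auto simp: W_def)
    show "\<rho> g *\<^sub>v v \<in> W" if g: "g \<in> carrier G" and v: "v \<in> W" for g v
    proof -
      have vc: "v \<in> carrier_vec n" using v by (simp add: W_def)
      have "\<rho> x *\<^sub>v (\<rho> g *\<^sub>v v) = \<rho> g *\<^sub>v v" if x: "x \<in> N" for x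
      proof -
        have xG: "x \<in> carrier G" using x by simp
        define y where "y = inv g \<otimes> x \<otimes> g"
        have y: "y \<in> N" "y \<in> carrier G" using N.inv_op_closed1[OF g x] by (auto simp: y_def)
        have "x \<otimes> g = g \<otimes> y" using xG g by (simp add: y_def group_simps)
        then have e: "\<rho> x * \<rho> g = \<rho> g * \<rho> y" using rho_mult xG g y(2) by metis
        have "\<rho> x *\<^sub>v (\<rho> g *\<^sub>v v) = (\<rho> x * \<rho> g) *\<^sub>v v"
          using assoc_mult_mat_vec[OF rho_carrier[OF xG] rho_carrier[OF g] vc] by simp
        also have "\<dots> = \<rho> g *\<^sub>v (\<rho> y *\<^sub>v v)"
          unfolding e using assoc_mult_mat_vec[OF rho_carrier[OF g] rho_carrier[OF y(2)] vc] by simp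
        also have "\<rho> y *\<^sub>v v = v" using v y by (simp add: W_def)
        finally show ?thesis .
      qed
      then show ?thesis using mult_mat_vec_carrier[OF rho_carrier[OF g] vc] by (simp add: W_def)
    qed
    show "w \<in> W" using w wfix N(2) by (auto simp: W_def)
    show "w \<noteq> 0\<^sub>v n" by (rule w0)
  qed
  then have "\<rho> x *\<^sub>v v = 1\<^sub>m n *\<^sub>v v" if "v \<in> carrier_vec n" for v
    using that x by (auto simp: W_def)
  then show ?thesis using x rho_carrier by (intro eq_mat_by_vec) auto
qed

end

section \<open>Multiplicities in permutation characters\<close>

text \<open>Frobenius reciprocity for the trivial character. After the two sums are swapped,
  conjugation by \<open>x\<close> can be removed because \<chi> is a class function, so all
  \<open>x\<close> contribute equally.\<close>

lemma (in group) char_inner_induced_principal: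
  assumes fin: "finite (carrier G)" and M: "subgroup M G"
    and cls: "\<And>g x. g \<in> carrier G \<Longrightarrow> x \<in> carrier G \<Longrightarrow> \<chi> (x \<otimes> g \<otimes> inv x) = \<chi> g"
  shows "char_inner G \<chi> (induced G M (principal_character M)) = (\<Sum>m\<in>M. \<chi> m) / of_nat (card M)"
proof -
  interpret M: subgroup M G by fact
  have inner: "(\<Sum>g\<in>carrier G. \<chi> g * (if x \<otimes> g \<otimes> inv x \<in> M then 1 else 0)) = (\<Sum>m\<in>M. \<chi> m)"
    if x: "x \<in> carrier G" for x
  proof -
    have "(\<Sum>g\<in>carrier G. \<chi> g * (if x \<otimes> g \<otimes> inv x \<in> M then 1 else 0))
        = (\<Sum>g\<in>carrier G. \<chi> (x \<otimes> g \<otimes> inv x) * (if x \<otimes> g \<otimes> inv x \<in> M then 1 else 0))"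
      using x by (intro sum.cong) (simp_all add: cls)
    also have "\<dots> = (\<Sum>g\<in>carrier G. \<chi> g * (if g \<in> M then 1 else 0))"
      by (rule sum.reindex_bij_witness[of _ "\<lambda>g. inv x \<otimes> g \<otimes> x" "\<lambda>g. x \<otimes> g \<otimes> inv x"])
        (use x in \<open>auto simp: group_simps\<close>)
    also have "\<dots> = (\<Sum>g\<in>carrier G. if g \<in> M then \<chi> g else 0)" by (intro sum.cong) auto
    also have "\<dots> = (\<Sum>m\<in>M. \<chi> m)"
      using fin M.subset by (simp add: sum.If_cases Int_absorb1)
    finally show ?thesis .
  qed
  have ind: "cnj (induced G M (principal_character M) g)
      = 1 / of_nat (card M) * (\<Sum>x\<in>carrier G. if x \<otimes> g \<otimes> inv x \<in> M then 1 else 0)"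
    if "g \<in> carrier G" for g
  proof -
    have "induced G M (principal_character M) g
      = 1 / of_nat (card M) * (\<Sum>x\<in>carrier G. if x \<otimes> g \<otimes> inv x \<in> M then 1 else 0)"
      using that by (simp add: induced_def principal_character_def Let_def cong: if_cong)
    then show ?thesis by (simp add: if_distrib[of cnj] cong: if_cong)
  qed
  have "(\<Sum>g\<in>carrier G. \<chi> g * cnj (induced G M (principal_character M) g))
      = 1 / of_nat (card M) * (\<Sum>g\<in>carrier G. \<Sum>x\<in>carrier G. \<chi> g * (if x \<otimes> g \<otimes> inv x \<in> M then 1 else 0))"
    unfolding sum_distrib_left by (intro sum.cong refl) (simp add: ind sum_distrib_left mult_ac)
  also have "(\<Sum>g\<in>carrier G. \<Sum>x\<in>carrier G. \<chi> g * (if x \<otimes> g \<otimes> inv x \<in> M then 1 else 0))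
      = (\<Sum>x\<in>carrier G. \<Sum>g\<in>carrier G. \<chi> g * (if x \<otimes> g \<otimes> inv x \<in> M then 1 else 0))"
    by (rule sum.swap)
  also have "\<dots> = (\<Sum>x\<in>carrier G. \<Sum>m\<in>M. \<chi> m)" by (intro sum.cong refl inner)
  also have "\<dots> = of_nat (card (carrier G)) * (\<Sum>m\<in>M. \<chi> m)" by simp
  finally have "(\<Sum>g\<in>carrier G. \<chi> g * cnj (induced G M (principal_character M) g))
      = 1 / of_nat (card M) * (of_nat (card (carrier G)) * (\<Sum>m\<in>M. \<chi> m))" .
  moreover have "card (carrier G) > 0" using fin one_closed by (auto simp: card_gt_0_iff)
  ultimately show ?thesis by (simp add: char_inner_def Coset.order_def)
qed

text \<open>The working form of the definition: a nonvanishing sum over \<open>M\<close> yields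
  \<open>M\<close>-fixed vectors directly, can be checked on explicit matrices and behaves well
  under inflation.\<close>

lemma P_pi_character_iff:
  fixes G (structure)
  assumes "group G" "finite (carrier G)"
  shows "P_pi_character \<pi> G \<chi> \<longleftrightarrow> \<chi> \<in> Irr G \<and>
     (\<exists>M. maximal_subgroup M G \<and> pi_number \<pi> (group_index G M) \<and> (\<Sum>m\<in>M. \<chi> m) \<noteq> 0)"
proof -
  interpret group G by fact
  have "char_inner G \<chi> (induced G M (principal_character M)) \<noteq> 0 \<longleftrightarrow> (\<Sum>m\<in>M. \<chi> m) \<noteq> 0"
    if \<chi>: "\<chi> \<in> Irr G" and M: "maximal_subgroup M G" for M
  proof -
    obtain n \<rho> where r: "irreducible_representation G n \<rho>" "\<chi> = character G \<rho>"
      using \<chi> by (auto simp: Irr_def)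
    interpret irreducible_rep G n \<rho>
      by unfold_locales (use assms r in auto)
    have Ms: "subgroup M G" using M by (simp add: maximal_subgroup_def)
    show ?thesis
      using char_inner_induced_principal[OF fin Ms, of \<chi>] character_conj r(2)
        card_subgroup_pos[OF fin Ms] by simp
  qed
  then show ?thesis unfolding P_pi_character_def by blast
qed

text \<open>A subgroup \<open>B\<close> maximal subject to omitting \<open>a\<close> is a complement
  of the cyclic group generated by \<open>a\<close>. The character kills \<open>B\<close> and sends
  \<open>a\<close> to a nontrivial p-th root of unity.\<close>

lemma (in comm_group) linear_character_separates:
  fixes p :: nat
  assumes fin: "finite (carrier G)" and p: "prime p"
    and exp: "\<And>x. x \<in> carrier G \<Longrightarrow> x [^] p = \<one>" and a: "a \<in> carrier G" "a \<noteq> \<one>"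
  obtains \<theta> :: "'a \<Rightarrow> complex"
  where "\<And>x y. x \<in> carrier G \<Longrightarrow> y \<in> carrier G \<Longrightarrow> \<theta> (x \<otimes> y) = \<theta> x * \<theta> y"
    and "\<theta> \<one> = 1" "\<theta> a \<noteq> 1"
proof -
  have powp: "x [^] (int p * l) = \<one>" if "x \<in> carrier G" for x and l :: int
    using that exp by (simp add: int_pow_pow[symmetric] int_pow_int)
  \<comment> \<open>Powers depend only on the exponent modulo \<open>p\<close>, and \<open>k\<close>
    is invertible modulo \<open>p\<close>.\<close>
  have bez: "\<exists>u :: int. \<forall>x\<in>carrier G. (x [^] k) [^] u = x" if k: "\<not> int p dvd k" for k
  proof -
    have "coprime (int p) k" using k p by (simp add: prime_imp_coprime)
    then obtain u v where uv: "u * int p + v * k = 1" using bezout_int[of "int p" k] by auto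
    have "(x [^] k) [^] v = x" if x: "x \<in> carrier G" for x
    proof -
      have kv: "k * v = 1 + int p * (- u)" using uv by (simp add: algebra_simps)
      have "(x [^] k) [^] v = x [^] (1 + int p * (- u))" using x kv by (simp add: int_pow_pow)
      also have "\<dots> = x [^] (1::int) \<otimes> x [^] (int p * (- u))" using x by (rule int_pow_mult)
      also have "\<dots> = x" using x powp[OF x, of "- u"] by simp
      finally show ?thesis .
    qed
    then show ?thesis by blast
  qed
  let ?S = "{B. subgroup B G \<and> a \<notin> B}"
  have "?S \<subseteq> Pow (carrier G)" by (metis (no_types, lifting) CollectD PowI subgroup.subset subsetI)
  then have finS: "finite ?S" using fin by (meson finite_Pow_iff finite_subset)
  have "{\<one>} \<in> ?S" using a triv_subgroup by simp
  from finite_has_maximal2[OF finS this] obtain B where B: "subgroup B G" "a \<notin> B"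
    and max: "\<forall>K\<in>?S. B \<subseteq> K \<longrightarrow> B = K" by auto
  interpret B: subgroup B G by fact
  have aB: "int p dvd i" if i: "a [^] i \<in> B" for i :: int
  proof (rule ccontr)
    assume "\<not> int p dvd i"
    from bez[OF this] obtain u where "(a [^] i) [^] (u::int) = a" using a by auto
    moreover have "(a [^] i) [^] u \<in> B" using subgroup_int_pow_closed[OF B(1) i] .
    ultimately show False using B(2) by simp
  qed
  have dec: "\<exists>b\<in>B. \<exists>i::int. x = b \<otimes> a [^] i" if x: "x \<in> carrier G" for x
  proof (cases "x \<in> B")
    case True
    then show ?thesis using a by (intro bexI[of _ x] exI[of _ 0]) auto
  next
    case False
    \<comment> \<open>\<open>K\<close> is generated by \<open>B\<close> and \<open>x\<close>. It is
      larger than \<open>B\<close>, so by maximality it contains \<open>a\<close>; the exponent of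
      \<open>x\<close> in the resulting equation is invertible modulo \<open>p\<close>, and the
      equation can be solved for \<open>x\<close>.\<close>
    define K where "K = {b \<otimes> x [^] k | b (k::int). b \<in> B}"
    have K: "subgroup K G"
    proof (rule subgroupI)
      show "K \<subseteq> carrier G" using x by (auto simp: K_def)
      have "\<one> \<otimes> x [^] (0::int) \<in> K" unfolding K_def using B.one_closed by blast
      then show "K \<noteq> {}" by blast
    next
      fix z assume "z \<in> K"
      then obtain b k where z: "b \<in> B" "z = b \<otimes> x [^] (k::int)" by (auto simp: K_def)
      then have "inv z = inv b \<otimes> x [^] (- k)" using x by (simp add: inv_mult int_pow_neg)
      with z show "inv z \<in> K" unfolding K_def using B.m_inv_closed by blast
    next
      fix z y assume "z \<in> K" "y \<in> K"
      then obtain b k c l where z: "b \<in> B" "z = b \<otimes> x [^] (k::int)" "c \<in> B" "y = c \<otimes> x [^] (l::int)"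
        by (auto simp: K_def)
      then have "z \<otimes> y = (b \<otimes> c) \<otimes> x [^] (k + l)" using x by (simp add: int_pow_mult m_ac)
      with z show "z \<otimes> y \<in> K" unfolding K_def using B.m_closed by blast
    qed
    have BK: "B \<subseteq> K"
    proof
      fix b assume b: "b \<in> B"
      then have "b = b \<otimes> x [^] (0::int)" by simp
      with b show "b \<in> K" unfolding K_def by blast
    qed
    have "x = \<one> \<otimes> x [^] (1::int)" using x by simp
    then have "x \<in> K" unfolding K_def using B.one_closed by blast
    then have "B \<noteq> K" using False by auto
    then have "a \<in> K" using max K BK by auto
    then obtain b k where bk: "b \<in> B" "a = b \<otimes> x [^] (k::int)" by (auto simp: K_def)
    have bG: "b \<in> carrier G" using bk by simp
    have "\<not> int p dvd k"
    proof
      assume "int p dvd k"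
      then have "x [^] k = \<one>" using powp[OF x] by (auto simp: dvd_def)
      then show False using bk B(2) bG by simp
    qed
    from bez[OF this] obtain u where u: "(x [^] k) [^] (u::int) = x" using x by auto
    have "a [^] u = b [^] u \<otimes> (x [^] k) [^] u" using bk x bG by (simp add: int_pow_distrib)
    then have "x = inv (b [^] u) \<otimes> a [^] u" using u x bG by (simp add: group_simps)
    moreover have "inv (b [^] u) \<in> B" using subgroup_int_pow_closed[OF B(1) bk(1)] by simp
    ultimately show ?thesis by blast
  qed
  have "card {z :: complex. z ^ p = 1} = p" using p prime_gt_0_nat by (intro card_roots_unity_eq) auto
  moreover have "{z :: complex. z ^ p = 1} \<noteq> {1}"
  proof
    assume "{z :: complex. z ^ p = 1} = {1}"
    with calculation have "p = 1" by simp
    with p show False by simp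
  qed
  ultimately obtain \<zeta> :: complex where z: "\<zeta> ^ p = 1" "\<zeta> \<noteq> 1" by auto
  have z0: "\<zeta> \<noteq> 0" using z p by (auto simp: power_0_left)
  have zp: "\<zeta> powi (int p * l) = 1" for l
    using z by (simp add: power_int_mult power_int_of_nat)
  \<comment> \<open>The exponent of \<open>a\<close> is determined modulo \<open>p\<close>, since
    \<open>a [^] i\<close> lies in \<open>B\<close> only when \<open>p\<close> divides
    \<open>i\<close>. This makes the description in \<open>\<theta>\<close> unique.\<close>
  have uni: "\<zeta> powi i = \<zeta> powi j" if "b \<in> B" "c \<in> B" "b \<otimes> a [^] i = c \<otimes> a [^] j" for b c and i j :: int
  proof -
    have G: "b \<in> carrier G" "c \<in> carrier G" using that by auto
    have "a [^] (i - j) = a [^] i \<otimes> inv (a [^] j)" using a by (simp add: int_pow_diff)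
    also have "a [^] i = inv b \<otimes> (c \<otimes> a [^] j)" using that(3)[symmetric] G a by (simp add: group_simps)
    finally have "a [^] (i - j) = inv b \<otimes> c" using G a by (simp add: group_simps)
    then have "int p dvd i - j" using that(1,2) by (intro aB) auto
    then obtain l where "i = j + int p * l" by (auto simp: dvd_def algebra_simps)
    then show ?thesis using z0 by (simp add: power_int_add zp)
  qed
  define \<theta> where "\<theta> x = (THE z. \<exists>b\<in>B. \<exists>i. x = b \<otimes> a [^] i \<and> z = \<zeta> powi i)" for x
  have lam: "\<theta> (b \<otimes> a [^] i) = \<zeta> powi i" if "b \<in> B" for b i
    unfolding \<theta>_def
  proof (rule the_equality)
    show "\<exists>c\<in>B. \<exists>j. b \<otimes> a [^] i = c \<otimes> a [^] j \<and> \<zeta> powi i = \<zeta> powi j" using that by blast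
    fix z assume "\<exists>c\<in>B. \<exists>j. b \<otimes> a [^] i = c \<otimes> a [^] j \<and> z = \<zeta> powi j"
    then obtain c j where "c \<in> B" "b \<otimes> a [^] i = c \<otimes> a [^] j" "z = \<zeta> powi j" by blast
    with uni[OF that, of c i j] show "z = \<zeta> powi i" by simp
  qed
  show thesis
  proof
    fix x y assume x: "x \<in> carrier G" and y: "y \<in> carrier G"
    obtain b i where xb: "b \<in> B" "x = b \<otimes> a [^] (i::int)" using dec[OF x] by blast
    obtain c j where yc: "c \<in> B" "y = c \<otimes> a [^] (j::int)" using dec[OF y] by blast
    have "x \<otimes> y = (b \<otimes> c) \<otimes> a [^] (i + j)" using xb yc a by (simp add: int_pow_mult m_ac)
    then show "\<theta> (x \<otimes> y) = \<theta> x * \<theta> y" using lam xb yc z0 by (simp add: power_int_add)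
  next
    show "\<theta> \<one> = 1" using lam[of \<one> 0] by simp
    show "\<theta> a \<noteq> 1" using lam[of \<one> 1] a z by simp
  qed
qed

section \<open>Linear characters of a complemented abelian normal subgroup\<close>

locale split_extension = group G for G :: "('a, 'b) monoid_scheme" (structure) +
  fixes N M :: "'a set"
  assumes fin: "finite (carrier G)" and N_normal: "N \<lhd> G"
    and ab: "x \<in> N \<Longrightarrow> y \<in> N \<Longrightarrow> x \<otimes> y = y \<otimes> x"
    and M_subgroup: "subgroup M G" and Int_one: "N \<inter> M = {\<one>}" and prod: "N <#> M = carrier G"
begin

sublocale N: normal N G by (rule N_normal)
sublocale M: subgroup M G by (rule M_subgroup)

lemma conj_N: "g \<in> carrier G \<Longrightarrow> x \<in> N \<Longrightarrow> inv g \<otimes> x \<otimes> g \<in> N"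
  using N.inv_op_closed1 .

text \<open>The \<open>N\<close>-part of g = n m. It labels the coset g M, and thereby identifies
  the permutation module on the cosets of \<open>M\<close> with functions on
  \<open>N\<close>.\<close>

definition proj :: "'a \<Rightarrow> 'a" where
  "proj g = (SOME n. n \<in> N \<and> inv n \<otimes> g \<in> M)"

lemma proj:
  assumes "g \<in> carrier G"
  shows "proj g \<in> N" "inv (proj g) \<otimes> g \<in> M"
proof -
  from assms prod have "g \<in> N <#> M" by simp
  then obtain n m where nm: "n \<in> N" "m \<in> M" "g = n \<otimes> m" by (auto simp: set_mult_def)
  then have "n \<in> N \<and> inv n \<otimes> g \<in> M" by (simp add: group_simps)
  then have "proj g \<in> N \<and> inv (proj g) \<otimes> g \<in> M" unfolding proj_def by (rule someI)
  then show "proj g \<in> N" "inv (proj g) \<otimes> g \<in> M" by auto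
qed

lemma proj_eq:
  assumes g: "g \<in> carrier G" and n: "n \<in> N" "inv n \<otimes> g \<in> M"
  shows "proj g = n"
proof -
  have p: "proj g \<in> N" "inv (proj g) \<otimes> g \<in> M" using proj[OF g] .
  have "(inv n \<otimes> g) \<otimes> inv (inv (proj g) \<otimes> g) \<in> M" using n(2) p(2) by blast
  then have "inv n \<otimes> proj g \<in> M" using g n(1) p(1) by (simp add: group_simps)
  moreover have "inv n \<otimes> proj g \<in> N" using n(1) p(1) by blast
  ultimately have "inv n \<otimes> proj g = \<one>" using Int_one by blast
  then have "n \<otimes> (inv n \<otimes> proj g) = n" using n(1) by simp
  then show ?thesis using n(1) p(1) by (simp add: group_simps)
qed

text \<open>With g = p m and h = q m', the product is p (m q m^-1) (m m'). Since \<open>N\<close> is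
  abelian, conjugating q by m or by g gives the same element.\<close>

lemma proj_mult:
  assumes g: "g \<in> carrier G" and h: "h \<in> carrier G"
  shows "proj (g \<otimes> h) = proj g \<otimes> (g \<otimes> proj h \<otimes> inv g)"
proof (rule proj_eq)
  have c: "g \<otimes> proj h \<otimes> inv g \<in> N" using N.inv_op_closed2 g proj(1)[OF h] by blast
  note pg = proj[OF g] and ph = proj[OF h]
  show "proj g \<otimes> (g \<otimes> proj h \<otimes> inv g) \<in> N" using c pg by blast
  have "proj g \<otimes> (g \<otimes> proj h \<otimes> inv g) = (g \<otimes> proj h \<otimes> inv g) \<otimes> proj g" using ab c pg by blast
  then have "inv (proj g \<otimes> (g \<otimes> proj h \<otimes> inv g)) \<otimes> (g \<otimes> h) = (inv (proj g) \<otimes> g) \<otimes> (inv (proj h) \<otimes> h)"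
    using g h pg(1) ph(1) by (simp add: group_simps)
  then show "inv (proj g \<otimes> (g \<otimes> proj h \<otimes> inv g)) \<otimes> (g \<otimes> h) \<in> M" using pg ph by simp
qed (use g h in simp)

lemma proj_N: "n \<in> N \<Longrightarrow> proj n = n" by (rule proj_eq) auto

lemma proj_M: "m \<in> M \<Longrightarrow> proj m = \<one>" by (rule proj_eq) auto

lemma card_index: "group_index G M = card N"
proof -
  have "card (carrier G) = card N * card M"
    using card_set_mult[OF N.subgroup_axioms M_subgroup] prod Int_one by simp
  with group_index_mult[OF fin M_subgroup] card_subgroup_pos[OF fin M_subgroup] show ?thesis by simp
qed

text \<open>Functions are cut off outside \<open>N\<close>, so that equality of HOL functions is
  equality of characters; orbits and stabilizers are then counted correctly.\<close>

definition linear_chars :: "('a \<Rightarrow> complex) set" where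
  "linear_chars = {\<mu> \<in> extensional N. (\<forall>x\<in>N. \<forall>y\<in>N. \<mu> (x \<otimes> y) = \<mu> x * \<mu> y) \<and> \<mu> \<one> = 1}"

text \<open>The inverse on the left of \<open>x\<close> makes this a left action.\<close>

definition act :: "'a \<Rightarrow> ('a \<Rightarrow> complex) \<Rightarrow> 'a \<Rightarrow> complex" where
  "act g \<mu> = (\<lambda>x\<in>N. \<mu> (inv g \<otimes> x \<otimes> g))"

lemma linear_charsD:
  assumes "\<mu> \<in> linear_chars"
  shows "x \<in> N \<Longrightarrow> y \<in> N \<Longrightarrow> \<mu> (x \<otimes> y) = \<mu> x * \<mu> y" "\<mu> \<one> = 1"
    "x \<in> N \<Longrightarrow> \<mu> (inv x) * \<mu> x = 1" "\<mu> \<in> extensional N"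
proof -
  show m: "x \<in> N \<Longrightarrow> y \<in> N \<Longrightarrow> \<mu> (x \<otimes> y) = \<mu> x * \<mu> y" for x y
    using assms by (simp add: linear_chars_def)
  show o: "\<mu> \<one> = 1" "\<mu> \<in> extensional N" using assms by (simp_all add: linear_chars_def)
  show "x \<in> N \<Longrightarrow> \<mu> (inv x) * \<mu> x = 1" using m[of "inv x" x] o by simp
qed

lemma act_linear_chars:
  assumes g: "g \<in> carrier G" and \<mu>: "\<mu> \<in> linear_chars"
  shows "act g \<mu> \<in> linear_chars"
proof -
  have "act g \<mu> (x \<otimes> y) = act g \<mu> x * act g \<mu> y" if x: "x \<in> N" and y: "y \<in> N" for x y
  proof -
    have "inv g \<otimes> (x \<otimes> y) \<otimes> g = (inv g \<otimes> x \<otimes> g) \<otimes> (inv g \<otimes> y \<otimes> g)" using x y g by (simp add: group_simps)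
    then show ?thesis using x y linear_charsD(1)[OF \<mu> conj_N[OF g x] conj_N[OF g y]] by (simp add: act_def)
  qed
  then show ?thesis using g linear_charsD(2)[OF \<mu>] by (simp add: linear_chars_def act_def)
qed

lemma act_mult:
  assumes "g \<in> carrier G" "h \<in> carrier G"
  shows "act (g \<otimes> h) \<mu> = act g (act h \<mu>)"
  using assms conj_N by (auto simp: act_def restrict_def group_simps)

lemma act_N:
  assumes n: "n \<in> N" and \<mu>: "\<mu> \<in> linear_chars"
  shows "act n \<mu> = \<mu>"
proof
  fix x show "act n \<mu> x = \<mu> x"
  proof (cases "x \<in> N")
    case True
    then have "inv n \<otimes> x \<otimes> n = x" using n ab[of x n] by (simp add: group_simps)
    then show ?thesis using True by (simp add: act_def)
  qed (use linear_charsD(4)[OF \<mu>] in \<open>simp add: act_def extensional_def\<close>)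
qed

lemma act_one: "\<mu> \<in> linear_chars \<Longrightarrow> act \<one> \<mu> = \<mu>"
  by (rule act_N) auto

lemma act_inv: "g \<in> carrier G \<Longrightarrow> \<mu> \<in> linear_chars \<Longrightarrow> act (inv g) (act g \<mu>) = \<mu>"
  using act_mult[of "inv g" g \<mu>] act_one by simp

lemma act_conj:
  assumes "g \<in> carrier G" "x \<in> N"
  shows "act g \<mu> (g \<otimes> x \<otimes> inv g) = \<mu> x"
  using assms N.inv_op_closed2 by (simp add: act_def group_simps)

text \<open>Where the characters differ, at \<open>a\<close> say, translation by \<open>a\<close>
  multiplies the sum by \<open>\<mu> (inv a) * \<nu> a\<close>, a factor other than 1, so the sum
  vanishes.\<close>

lemma linear_chars_orthogonal:
  assumes \<mu>: "\<mu> \<in> linear_chars" and \<nu>: "\<nu> \<in> linear_chars"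
  shows "(\<Sum>n\<in>N. \<mu> (inv n) * \<nu> n) = (if \<mu> = \<nu> then of_nat (card N) else 0)"
proof (cases "\<mu> = \<nu>")
  case True
  then show ?thesis using linear_charsD(3)[OF \<mu>] by simp
next
  case False
  then obtain a where a: "\<mu> a \<noteq> \<nu> a" by blast
  have aN: "a \<in> N"
    using a extensional_arb[OF linear_charsD(4)[OF \<mu>]] extensional_arb[OF linear_charsD(4)[OF \<nu>]] by metis
  define S where "S = (\<Sum>n\<in>N. \<mu> (inv n) * \<nu> n)"
  have "S = (\<Sum>n\<in>N. \<mu> (inv (a \<otimes> n)) * \<nu> (a \<otimes> n))" unfolding S_def
    by (rule sum.reindex_bij_witness[of _ "\<lambda>n. a \<otimes> n" "\<lambda>n. inv a \<otimes> n"])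
      (use aN in \<open>auto simp: group_simps\<close>)
  also have "\<dots> = (\<Sum>n\<in>N. \<mu> (inv a) * \<nu> a * (\<mu> (inv n) * \<nu> n))"
  proof (rule sum.cong)
    fix n assume n: "n \<in> N"
    then have "inv (a \<otimes> n) = inv n \<otimes> inv a" using aN by (simp add: inv_mult_group)
    then show "\<mu> (inv (a \<otimes> n)) * \<nu> (a \<otimes> n) = \<mu> (inv a) * \<nu> a * (\<mu> (inv n) * \<nu> n)"
      using n aN linear_charsD(1)[OF \<mu>] linear_charsD(1)[OF \<nu>] by simp
  qed simp
  also have "\<dots> = \<mu> (inv a) * \<nu> a * S" by (simp add: S_def sum_distrib_left)
  finally have e: "S = \<mu> (inv a) * \<nu> a * S" .
  have "S = 0"
  proof (rule ccontr)
    assume "S \<noteq> 0"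
    with e have 1: "\<mu> (inv a) * \<nu> a = 1" by simp
    with linear_charsD(3)[OF \<mu> aN] have "\<mu> (inv a) * \<nu> a = \<mu> (inv a) * \<mu> a" by simp
    with 1 have "\<nu> a = \<mu> a" by (metis mult_cancel_left mult_zero_left zero_neq_one)
    with a show False by simp
  qed
  with False show ?thesis by (simp add: S_def)
qed

definition orbit_of :: "('a \<Rightarrow> complex) \<Rightarrow> ('a \<Rightarrow> complex) set" where
  "orbit_of \<mu> = (\<lambda>g. act g \<mu>) ` carrier G"

definition stab :: "('a \<Rightarrow> complex) \<Rightarrow> 'a set" where
  "stab \<mu> = {g \<in> carrier G. act g \<mu> = \<mu>}"

lemma stab_subgroup:
  assumes \<mu>: "\<mu> \<in> linear_chars"
  shows "subgroup (stab \<mu>) G"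
proof (rule subgroupI)
  show "stab \<mu> \<subseteq> carrier G" by (auto simp: stab_def)
  show "stab \<mu> \<noteq> {}" using act_one[OF \<mu>] by (auto simp: stab_def)
next
  fix a assume "a \<in> stab \<mu>"
  then show "inv a \<in> stab \<mu>" using act_inv[of a \<mu>] \<mu> by (auto simp: stab_def)
next
  fix a b assume "a \<in> stab \<mu>" "b \<in> stab \<mu>"
  then show "a \<otimes> b \<in> stab \<mu>" using act_mult by (auto simp: stab_def)
qed

text \<open>Orbit-stabilizer: the fibre of \<open>act g \<mu>\<close> over a point
  \<open>act h \<mu>\<close> of the orbit is the left coset of the stabilizer by
  \<open>h\<close>.\<close>

lemma index_stab:
  assumes \<mu>: "\<mu> \<in> linear_chars"
  shows "group_index G (stab \<mu>) = card (orbit_of \<mu>)"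
proof -
  have fib: "card {g \<in> carrier G. act g \<mu> = \<nu>} = card (stab \<mu>)" if \<nu>: "\<nu> \<in> orbit_of \<mu>" for \<nu>
  proof -
    obtain h where h: "h \<in> carrier G" "\<nu> = act h \<mu>" using \<nu> by (auto simp: orbit_of_def)
    have 0: "act (inv h \<otimes> g) \<mu> = \<mu>" if "g \<in> carrier G" "act g \<mu> = \<nu>" for g
      using act_mult[of "inv h" g \<mu>] act_inv[OF h(1) \<mu>] that h by simp
    have 1: "act (h \<otimes> g) \<mu> = \<nu>" if "g \<in> carrier G" "act g \<mu> = \<mu>" for g
      using act_mult[of h g \<mu>] that h by simp
    have "bij_betw (\<lambda>g. h \<otimes> g) (stab \<mu>) {g \<in> carrier G. act g \<mu> = \<nu>}"
    proof (intro bij_betw_byWitness[of _ "\<lambda>g. inv h \<otimes> g"] ballI subsetI)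
      fix g assume "g \<in> stab \<mu>"
      then show "inv h \<otimes> (h \<otimes> g) = g" using h(1) by (simp add: stab_def group_simps)
    next
      fix g assume "g \<in> {g \<in> carrier G. act g \<mu> = \<nu>}"
      then show "h \<otimes> (inv h \<otimes> g) = g" using h(1) by (simp add: group_simps)
    next
      fix x assume "x \<in> (\<lambda>g. h \<otimes> g) ` stab \<mu>"
      then show "x \<in> {g \<in> carrier G. act g \<mu> = \<nu>}" using 1 h(1) by (auto simp: stab_def)
    next
      fix x assume "x \<in> (\<lambda>g. inv h \<otimes> g) ` {g \<in> carrier G. act g \<mu> = \<nu>}"
      then obtain g where "g \<in> carrier G" "act g \<mu> = \<nu>" "x = inv h \<otimes> g" by blast
      then show "x \<in> stab \<mu>" using 0[of g] h(1) by (simp add: stab_def)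
    qed
    from bij_betw_same_card[OF this] show ?thesis by (rule sym)
  qed
  have "card (carrier G) = (\<Sum>\<nu>\<in>orbit_of \<mu>. \<Sum>g\<in>{g \<in> carrier G. act g \<mu> = \<nu>}. 1)"
    using fin sum.group[of "carrier G" "orbit_of \<mu>" "\<lambda>g. act g \<mu>" "\<lambda>_. 1::nat"] by (simp add: orbit_of_def)
  also have "\<dots> = card (orbit_of \<mu>) * card (stab \<mu>)" using fib by simp
  finally show ?thesis
    using group_index_mult[OF fin stab_subgroup[OF \<mu>]] card_subgroup_pos[OF fin stab_subgroup[OF \<mu>]] by simp
qed

text \<open>The irreducible constituent of the permutation representation on the cosets of \<open>M\<close> that is
  spanned by the \<open>N\<close>-eigenvectors with eigenvalues in the orbit of \<open>\<mu>\<close>. Since \<open>proj\<close> is a crossed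
  homomorphism, it is given by monomial matrices.\<close>

lemma monomial_representation:
  assumes \<mu>: "\<mu> \<in> linear_chars"
  obtains \<rho> where "irreducible_representation G (card (orbit_of \<mu>)) \<rho>"
    "(\<Sum>m\<in>M. character G \<rho> m) \<noteq> 0"
proof -
  define d where "d = card (orbit_of \<mu>)"
  have finO: "finite (orbit_of \<mu>)" using fin by (simp add: orbit_of_def)
  obtain e where e: "bij_betw e {..<d} (orbit_of \<mu>)"
    using ex_bij_betw_nat_finite[OF finO] by (auto simp: d_def atLeast0LessThan)
  have einj: "e i = e j \<longleftrightarrow> i = j" if "i < d" "j < d" for i j
    using e that by (auto simp: bij_betw_def inj_on_def)
  have eO: "e i \<in> orbit_of \<mu>" if "i < d" for i using e that by (auto simp: bij_betw_def)
  have eL: "e i \<in> linear_chars" if "i < d" for i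
    using eO[OF that] act_linear_chars \<mu> by (auto simp: orbit_of_def)
  have eact: "\<exists>j<d. e j = act g (e i)" if g: "g \<in> carrier G" and i: "i < d" for g i
  proof -
    obtain h where "h \<in> carrier G" "e i = act h \<mu>" using eO[OF i] by (auto simp: orbit_of_def)
    then have "act g (e i) = act (g \<otimes> h) \<mu>" "g \<otimes> h \<in> carrier G" using g by (auto simp: act_mult)
    then have "act g (e i) \<in> orbit_of \<mu>" by (auto simp: orbit_of_def)
    then obtain j where "j < d" "act g (e i) = e j" using e by (auto simp: bij_betw_def)
    then show ?thesis by metis
  qed
  have etrans: "\<exists>g\<in>carrier G. e j = act g (e i)" if i: "i < d" and j: "j < d" for i j
  proof -
    obtain h where h: "h \<in> carrier G" "e i = act h \<mu>" using eO[OF i] by (auto simp: orbit_of_def)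
    obtain k where k: "k \<in> carrier G" "e j = act k \<mu>" using eO[OF j] by (auto simp: orbit_of_def)
    have "act (k \<otimes> inv h) (e i) = e j" using h k act_inv[OF h(1) \<mu>] by (simp add: act_mult)
    then show ?thesis using h k by (metis inv_closed m_closed)
  qed
  have d0: "d > 0"
    using finO one_closed by (auto simp: d_def card_gt_0_iff orbit_of_def)
  \<comment> \<open>The j-th basis vector stands for the \<open>N\<close>-eigenvector \<Sum>n.
    e_j(n^-1) nM in the permutation module. The crossed homomorphism law shows that g sends it to
    e_i(proj g) times the i-th one, where e_i = g e_j.\<close>
  define \<rho> where "\<rho> g = mat d d (\<lambda>(i, j). if e i = act g (e j) then e i (proj g) else 0)" for g
  have \<rho>car: "\<rho> g \<in> carrier_mat d d" for g by (simp add: \<rho>_def)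
  have \<rho>ent: "\<rho> g $$ (i, j) = (if e i = act g (e j) then e i (proj g) else 0)" if "i < d" "j < d" for g i j
    using that by (simp add: \<rho>_def)
  have rep: "representation G d \<rho>"
  proof (rule representationI[OF is_group \<rho>car])
    show "\<rho> \<one> = 1\<^sub>m d"
    proof (rule eq_matI)
      fix i j assume "i < dim_row (1\<^sub>m d)" "j < dim_col (1\<^sub>m d)"
      then have ij: "i < d" "j < d" by auto
      then show "\<rho> \<one> $$ (i, j) = 1\<^sub>m d $$ (i, j)"
        using einj act_one[OF eL] proj_N[of \<one>] linear_charsD(2)[OF eL] by (simp add: \<rho>ent)
    qed (simp_all add: \<rho>_def)
    fix g h assume g: "g \<in> carrier G" and h: "h \<in> carrier G"
    show "\<rho> (g \<otimes> h) = \<rho> g * \<rho> h"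
    proof (rule eq_matI)
      fix i k assume "i < dim_row (\<rho> g * \<rho> h)" "k < dim_col (\<rho> g * \<rho> h)"
      then have ik: "i < d" "k < d" using \<rho>car[of g] \<rho>car[of h] by auto
      \<comment> \<open>Only this column index survives in the matrix product, because
        \<open>h\<close> sends basis vector \<open>k\<close> to a multiple of basis vector
        \<open>j\<close>.\<close>
      obtain j where j: "j < d" "e j = act h (e k)" using eact[OF h ik(2)] by auto
      have "(\<rho> g * \<rho> h) $$ (i, k) = (\<Sum>l<d. \<rho> g $$ (i, l) * \<rho> h $$ (l, k))"
        using ik by (rule index_mult_mat_sum[OF \<rho>car \<rho>car])
      also have "\<dots> = (\<Sum>l<d. if l = j then \<rho> g $$ (i, j) * \<rho> h $$ (j, k) else 0)"
      proof (rule sum.cong)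
        fix l assume "l \<in> {..<d}"
        then have l: "l < d" by simp
        then have "\<rho> h $$ (l, k) = 0" if "l \<noteq> j"
          using that j ik einj[OF l j(1)] by (simp add: \<rho>ent)
        then show "\<rho> g $$ (i, l) * \<rho> h $$ (l, k) = (if l = j then \<rho> g $$ (i, j) * \<rho> h $$ (j, k) else 0)"
          by auto
      qed simp
      also have "\<dots> = \<rho> g $$ (i, j) * \<rho> h $$ (j, k)" using j by simp
      also have "\<dots> = \<rho> (g \<otimes> h) $$ (i, k)"
      proof (cases "e i = act g (e j)")
        case True
        have ph: "g \<otimes> proj h \<otimes> inv g \<in> N" using N.inv_op_closed2 g proj(1)[OF h] by blast
        have "e i (proj (g \<otimes> h)) = e i (proj g) * e i (g \<otimes> proj h \<otimes> inv g)"
          using proj_mult[OF g h] linear_charsD(1)[OF eL[OF ik(1)] proj(1)[OF g] ph] by simp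
        also have "e i (g \<otimes> proj h \<otimes> inv g) = e j (proj h)"
          using True act_conj[OF g proj(1)[OF h]] by simp
        finally show ?thesis using True j ik g h by (simp add: \<rho>ent act_mult)
      next
        case False
        then show ?thesis using j ik g h by (simp add: \<rho>ent act_mult)
      qed
      finally show "\<rho> (g \<otimes> h) $$ (i, k) = (\<rho> g * \<rho> h) $$ (i, k)" by simp
    qed (simp_all add: \<rho>_def)
  qed
  have \<rho>N: "(\<rho> n *\<^sub>v w) $ j = e j n * w $ j" if n: "n \<in> N" and w: "w \<in> carrier_vec d" and j: "j < d" for n w j
  proof -
    have "(\<rho> n *\<^sub>v w) $ j = (\<Sum>k<d. \<rho> n $$ (j, k) * w $ k)"
      by (rule index_mult_mat_vec_sum[OF \<rho>car w j])
    also have "\<dots> = (\<Sum>k<d. if k = j then e j n * w $ j else 0)"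
      using j einj act_N[OF n eL] proj_N[OF n] by (intro sum.cong) (auto simp: \<rho>ent)
    finally show ?thesis using j by simp
  qed
  have \<rho>unit: "\<rho> g *\<^sub>v unit_vec d i = e j (proj g) \<cdot>\<^sub>v unit_vec d j"
    if i: "i < d" and j: "j < d" "e j = act g (e i)" for g i j
  proof (rule eq_vecI)
    fix k assume "k < dim_vec (e j (proj g) \<cdot>\<^sub>v unit_vec d j)"
    then have k: "k < d" by simp
    have "(\<rho> g *\<^sub>v unit_vec d i) $ k = (\<Sum>l<d. \<rho> g $$ (k, l) * unit_vec d i $ l)"
      using k by (intro index_mult_mat_vec_sum[OF \<rho>car]) auto
    also have "\<dots> = (\<Sum>l<d. if l = i then \<rho> g $$ (k, i) else 0)"
      using i by (intro sum.cong) auto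
    also have "\<dots> = \<rho> g $$ (k, i)" using i by simp
    finally show "(\<rho> g *\<^sub>v unit_vec d i) $ k = (e j (proj g) \<cdot>\<^sub>v unit_vec d j) $ k"
      using i j k einj[OF k j(1)] by (auto simp: \<rho>ent)
  qed (simp add: \<rho>_def)
  have irr: "irreducible_representation G d \<rho>"
    unfolding irreducible_representation_def subspace_iff
  proof (intro conjI allI impI rep d0)
    fix W assume "(W \<subseteq> carrier_vec d \<and> 0\<^sub>v d \<in> W \<and> (\<forall>v\<in>W. \<forall>w\<in>W. v + w \<in> W) \<and> (\<forall>c. \<forall>v\<in>W. c \<cdot>\<^sub>v v \<in> W)) \<and>
      (\<forall>g\<in>carrier G. \<forall>w\<in>W. \<rho> g *\<^sub>v w \<in> W)"
    then have W: "W \<subseteq> carrier_vec d" "0\<^sub>v d \<in> W" and Wadd: "\<And>v w. v \<in> W \<Longrightarrow> w \<in> W \<Longrightarrow> v + w \<in> W"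
      and Wsm: "\<And>c v. v \<in> W \<Longrightarrow> c \<cdot>\<^sub>v v \<in> W"
      and Winv: "\<And>g w. g \<in> carrier G \<Longrightarrow> w \<in> W \<Longrightarrow> \<rho> g *\<^sub>v w \<in> W" by auto
    \<comment> \<open>The index type stays free because the sums run once over \<open>N\<close> and
      once over the coordinates.\<close>
    have Wsum: "vec d (\<lambda>j. \<Sum>s\<in>S. f s j) \<in> W" if "finite S" "\<And>s. s \<in> S \<Longrightarrow> vec d (f s) \<in> W"
      for S and f :: "'s \<Rightarrow> nat \<Rightarrow> complex"
      using that
    proof (induction S)
      case empty
      have "vec d (\<lambda>j. \<Sum>s\<in>{}. f s j) = 0\<^sub>v d" by (intro eq_vecI) auto
      then show ?case using W by simp
    next
      case (insert s S)
      have "vec d (\<lambda>j. \<Sum>s\<in>insert s S. f s j) = vec d (f s) + vec d (\<lambda>j. \<Sum>s\<in>S. f s j)"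
        using insert by (intro eq_vecI) auto
      then show ?case using insert Wadd by simp
    qed
    show "W = {0\<^sub>v d} \<or> W = carrier_vec d"
    proof (cases "W = {0\<^sub>v d}")
      case False
      then obtain w where w: "w \<in> W" "w \<noteq> 0\<^sub>v d" using W by blast
      have wc: "w \<in> carrier_vec d" using w W by blast
      then obtain i where i: "i < d" "w $ i \<noteq> 0"
        using w(2) by (metis carrier_vecD eq_vecI index_zero_vec)
      \<comment> \<open>Averaging over \<open>N\<close> against \<open>e i (inv n)\<close> is |N|
        times the projection to the eigenspace of \<open>e i\<close>. That space is the i-th
        coordinate line, since the characters \<open>e j\<close> are pairwise distinct.\<close>
      have "vec d (\<lambda>j. \<Sum>n\<in>N. e i (inv n) * e j n * w $ j) \<in> W"
      proof (rule Wsum)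
        show "finite N" using fin N.subset finite_subset by blast
        fix n assume n: "n \<in> N"
        have "vec d (\<lambda>j. e i (inv n) * e j n * w $ j) = e i (inv n) \<cdot>\<^sub>v (\<rho> n *\<^sub>v w)"
          using \<rho>car[of n] \<rho>N[OF n wc] by (intro eq_vecI) (simp_all add: \<rho>_def mult.assoc)
        then show "vec d (\<lambda>j. e i (inv n) * e j n * w $ j) \<in> W" using Wsm Winv n w(1) by simp
      qed
      also have "vec d (\<lambda>j. \<Sum>n\<in>N. e i (inv n) * e j n * w $ j) = (of_nat (card N) * w $ i) \<cdot>\<^sub>v unit_vec d i"
      proof (rule eq_vecI)
        fix j assume "j < dim_vec ((of_nat (card N) * w $ i) \<cdot>\<^sub>v unit_vec d i)"
        then have j: "j < d" by simp
        have "(\<Sum>n\<in>N. e i (inv n) * e j n * w $ j) = (\<Sum>n\<in>N. e i (inv n) * e j n) * w $ j"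
          by (simp add: sum_distrib_right)
        then show "vec d (\<lambda>j. \<Sum>n\<in>N. e i (inv n) * e j n * w $ j) $ j
            = ((of_nat (card N) * w $ i) \<cdot>\<^sub>v unit_vec d i) $ j"
          using i j linear_chars_orthogonal[OF eL[OF i(1)] eL[OF j]] einj[OF i(1) j] by auto
      qed simp
      finally have "(1 / (of_nat (card N) * w $ i)) \<cdot>\<^sub>v ((of_nat (card N) * w $ i) \<cdot>\<^sub>v unit_vec d i) \<in> W"
        by (rule Wsm)
      moreover have "of_nat (card N) * w $ i \<noteq> 0"
        using i(2) card_subgroup_pos[OF fin N.subgroup_axioms] by simp
      ultimately have ui: "unit_vec d i \<in> W" by (simp add: smult_smult_assoc)
      \<comment> \<open>\<open>G\<close> is transitive on the orbit, so some \<open>g\<close> moves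
        line \<open>i\<close> to line \<open>j\<close>; the coefficient \<open>e j (proj g)\<close>
        is a unit with inverse \<open>e j (inv (proj g))\<close>.\<close>
      have uj: "unit_vec d j \<in> W" if j: "j < d" for j
      proof -
        obtain g where g: "g \<in> carrier G" "e j = act g (e i)" using etrans[OF i(1) j] by auto
        have "e j (proj g) \<cdot>\<^sub>v unit_vec d j \<in> W"
          using Winv[OF g(1) ui] \<rho>unit[OF i(1) j g(2)] by simp
        then have "(e j (inv (proj g))) \<cdot>\<^sub>v (e j (proj g) \<cdot>\<^sub>v unit_vec d j) \<in> W" by (rule Wsm)
        then show ?thesis
          using linear_charsD(3)[OF eL[OF j] proj(1)[OF g(1)]] by (simp add: smult_smult_assoc)
      qed
      have "v \<in> W" if v: "v \<in> carrier_vec d" for v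
      proof -
        have "vec d (\<lambda>j. \<Sum>k\<in>{..<d}. v $ k * (if j = k then 1 else 0)) \<in> W"
        proof (rule Wsum)
          fix k assume "k \<in> {..<d}"
          then have k: "k < d" by simp
          have "vec d (\<lambda>j. v $ k * (if j = k then 1 else 0)) = v $ k \<cdot>\<^sub>v unit_vec d k"
            using k by (intro eq_vecI) auto
          then show "vec d (\<lambda>j. v $ k * (if j = k then 1 else 0)) \<in> W" using Wsm uj[OF k] by simp
        qed simp
        also have "vec d (\<lambda>j. \<Sum>k\<in>{..<d}. v $ k * (if j = k then 1 else 0)) = v"
          using v by (intro eq_vecI) (auto simp: if_distrib cong: if_cong)
        finally show ?thesis .
      qed
      then show ?thesis using W by blast
    qed simp
  qed
  \<comment> \<open>\<open>proj\<close> is trivial on \<open>M\<close>, so \<open>M\<close> acts by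
    permutation matrices and the trace counts fixed points. The sum over \<open>M\<close> is then a
    natural number to which the identity already contributes \<open>d\<close>.\<close>
  have chi: "character G \<rho> m = of_nat (card {i. i < d \<and> e i = act m (e i)})" if m: "m \<in> M" for m
  proof -
    have "character G \<rho> m = (\<Sum>i<d. if e i = act m (e i) then 1 else 0)"
      using m proj_M[OF m] linear_charsD(2)[OF eL]
      by (auto simp: character_def mat_trace_def \<rho>ent \<rho>car[THEN carrier_matD(1)] intro!: sum.cong)
    also have "\<dots> = of_nat (card {i. i < d \<and> e i = act m (e i)})"
      by (simp add: sum.If_cases Collect_conj_eq lessThan_def)
    finally show ?thesis .
  qed
  have "(\<Sum>m\<in>M. character G \<rho> m) = of_nat (\<Sum>m\<in>M. card {i. i < d \<and> e i = act m (e i)})"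
    by (simp add: chi)
  moreover have "(\<Sum>m\<in>M. card {i. i < d \<and> e i = act m (e i)}) > 0"
  proof (rule sum_pos2[of _ \<one>])
    show "finite M" using fin M.subset finite_subset by blast
    have "{i. i < d \<and> e i = act \<one> (e i)} = {..<d}" using act_one[OF eL] by auto
    then show "0 < card {i. i < d \<and> e i = act \<one> (e i)}" using d0 by simp
  qed auto
  ultimately have "(\<Sum>m\<in>M. character G \<rho> m) \<noteq> 0" by (simp only: of_nat_eq_0_iff neq0_conv)
  with irr show thesis by (intro that) (simp_all add: d_def)
qed

text \<open>A failure to commute yields a nontrivial commutator in \<open>N\<close>, which some
  linear character detects. That character has an orbit of pi-length and is therefore fixed by
  \<open>X\<close>, but a fixed character is trivial on such commutators.\<close>

lemma centralizes:
  assumes M: "maximal_subgroup M G" and piN: "pi_number \<pi> (card N)"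
    and el: "elementary_abelian p (G\<lparr>carrier := N\<rparr>)"
    and X: "X \<lhd> G" and NX: "N \<subseteq> X" and card: "card X = card N * m" "pi_number (prime_complement \<pi>) m"
    and deg: "\<And>\<chi>. P_pi_character \<pi> G \<chi> \<Longrightarrow> \<exists>d. \<chi> \<one> = of_nat d \<and> pi_number \<pi> d"
    and x: "x \<in> X" and n: "n \<in> N"
  shows "x \<otimes> n = n \<otimes> x"
proof (rule ccontr)
  assume neq: "x \<otimes> n \<noteq> n \<otimes> x"
  interpret A: comm_group "G\<lparr>carrier := N\<rparr>" using el by (simp add: elementary_abelian_def)
  have xG: "x \<in> carrier G" using x normal_imp_subgroup[OF X] subgroup.subset by blast
  define y where "y = inv x \<otimes> n \<otimes> x"
  have y: "y \<in> N" unfolding y_def using xG n by (rule conj_N)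
  \<comment> \<open>The commutator of \<open>n\<close> and \<open>x\<close>: nontrivial because they
    do not commute, and in the kernel of every linear character fixed by \<open>x\<close>.\<close>
  define a where "a = inv n \<otimes> y"
  have a: "a \<in> N" using n y by (simp add: a_def)
  have "a \<noteq> \<one>"
  proof
    assume "a = \<one>"
    then have "n \<otimes> (inv n \<otimes> y) = n" using n by (simp add: a_def)
    then have "y = n" using n y by (simp add: group_simps)
    then have "x \<otimes> n = x \<otimes> (inv x \<otimes> n \<otimes> x)" by (simp add: y_def)
    also have "\<dots> = n \<otimes> x" using xG n by (simp add: group_simps)
    finally show False using neq by simp
  qed
  have "\<exists>\<theta> :: 'a \<Rightarrow> complex. (\<forall>x\<in>N. \<forall>y\<in>N. \<theta> (x \<otimes> y) = \<theta> x * \<theta> y) \<and> \<theta> \<one> = 1 \<and> \<theta> a \<noteq> 1"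
  proof (rule A.linear_character_separates[of p a])
    show "finite (carrier (G\<lparr>carrier := N\<rparr>))" "prime p" using el by (simp_all add: elementary_abelian_def)
    show "x [^]\<^bsub>G\<lparr>carrier := N\<rparr>\<^esub> p = \<one>\<^bsub>G\<lparr>carrier := N\<rparr>\<^esub>" if "x \<in> carrier (G\<lparr>carrier := N\<rparr>)" for x
      using el that unfolding elementary_abelian_def by blast
    show "a \<in> carrier (G\<lparr>carrier := N\<rparr>)" "a \<noteq> \<one>\<^bsub>G\<lparr>carrier := N\<rparr>\<^esub>" using a \<open>a \<noteq> \<one>\<close> by simp_all
  qed auto
  then obtain \<theta> :: "'a \<Rightarrow> complex" where \<theta>: "\<And>x y. x \<in> N \<Longrightarrow> y \<in> N \<Longrightarrow> \<theta> (x \<otimes> y) = \<theta> x * \<theta> y"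
    and \<theta>1: "\<theta> \<one> = 1" "\<theta> a \<noteq> 1" by blast
  define \<mu> where "\<mu> = restrict \<theta> N"
  have \<mu>: "\<mu> \<in> linear_chars" using \<theta> \<theta>1 by (simp add: linear_chars_def \<mu>_def)
  obtain \<rho> where r: "irreducible_representation G (card (orbit_of \<mu>)) \<rho>"
    "(\<Sum>m\<in>M. character G \<rho> m) \<noteq> 0" using monomial_representation[OF \<mu>] .
  interpret irreducible_rep G "card (orbit_of \<mu>)" \<rho> using fin r by unfold_locales
  have "P_pi_character \<pi> G (character G \<rho>)"
    unfolding P_pi_character_iff[OF is_group fin] using r M piN card_index by (auto simp: Irr_def)
  from deg[OF this] have "pi_number \<pi> (card (orbit_of \<mu>))"
    using character_one by (metis of_nat_eq_iff)
  then have ind: "pi_number \<pi> (group_index G (stab \<mu>))" by (simp add: index_stab[OF \<mu>])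
  have "N \<subseteq> stab \<mu>" using act_N[OF _ \<mu>] by (auto simp: stab_def)
  then have "X \<subseteq> stab \<mu>"
    using normal_subset_of_index[OF fin X stab_subgroup[OF \<mu>] N.subgroup_axioms NX _ card ind] by blast
  then have "act x \<mu> = \<mu>" using x by (auto simp: stab_def)
  then have "act x \<mu> n = \<mu> n" by simp
  then have "\<theta> y = \<theta> n" using n y by (simp add: act_def \<mu>_def y_def)
  then have "\<theta> a = \<theta> (inv n) * \<theta> n" using \<theta>[of "inv n" y] n y by (simp add: a_def)
  also have "\<dots> = 1" using \<theta>[of "inv n" n] n \<theta>1 by simp
  finally show False using \<theta>1 by simp
qed

end

section \<open>The step across an abelian chief factor\<close>

lemma elementary_abelian_order:
  assumes el: "elementary_abelian p A" and p: "p \<in> \<pi>"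
  shows "pi_number \<pi> (Coset.order A)"
proof -
  interpret comm_group A using el by (simp add: elementary_abelian_def)
  have fin: "finite (carrier A)" and pp: "prime p" and exp: "\<And>x. x \<in> carrier A \<Longrightarrow> x [^]\<^bsub>A\<^esub> p = \<one>\<^bsub>A\<^esub>"
    using el by (auto simp: elementary_abelian_def)
  have "q = p" if q: "prime q" "q dvd Coset.order A" for q
  proof (rule ccontr)
    assume "q \<noteq> p"
    \<comment> \<open>Sylow's theorem with exponent 1 serves as Cauchy's theorem: it gives an
      element of order \<open>q\<close>, against the exponent \<open>p\<close>.\<close>
    obtain m where "Coset.order A = q ^ 1 * m" using q(2) by auto
    from sylow_thm[OF q(1) is_group this fin] obtain H where H: "subgroup H A" "card H = q" by auto
    interpret H: group "A\<lparr>carrier := H\<rparr>" using H(1) by (rule subgroup_imp_group)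
    have "H \<noteq> {\<one>\<^bsub>A\<^esub>}" using H(2) q(1) by auto
    then obtain x where x: "x \<in> H" "x \<noteq> \<one>\<^bsub>A\<^esub>" using subgroup.one_closed[OF H(1)] by blast
    have xA: "x \<in> carrier A" using x H(1) subgroup.subset by blast
    have "x [^]\<^bsub>A\<^esub> q = \<one>\<^bsub>A\<^esub>"
      using H.pow_order_eq_1[of x] x H(2) by (simp add: nat_pow_consistent[symmetric] Coset.order_def)
    then have "ord x dvd q" using pow_eq_id[OF xA] by simp
    moreover have "ord x dvd p" using pow_eq_id[OF xA] exp[OF xA] by simp
    moreover have "coprime p q" using pp q(1) \<open>q \<noteq> p\<close> by (simp add: primes_coprime)
    ultimately have "ord x = 1" by (metis coprime_common_divisor_nat coprime_commute)
    then show False using x(2) ord_eq_1[OF xA] by metis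
  qed
  then show ?thesis using p order_gt_0_iff_finite fin by (auto simp: pi_number_def)
qed

text \<open>Lifts a normal pi-complement of G/N, given by its preimage \<open>X\<close>, to
  \<open>G\<close>. If the Schur-Zassenhaus complement \<open>H\<close> failed to be normal, that
  very failure would supply the maximal subgroup needed to prove it normal.\<close>

lemma (in group) complement_step:
  assumes fin: "finite (carrier G)" and N: "N \<lhd> G"
    and min: "\<And>L. L \<lhd> G \<Longrightarrow> L \<subseteq> N \<Longrightarrow> L = {\<one>} \<or> L = N"
    and el: "elementary_abelian p (G\<lparr>carrier := N\<rparr>)" and p: "p \<in> \<pi>"
    and X: "X \<lhd> G" and NX: "N \<subseteq> X" and card: "card X = card N * m" "pi_number (prime_complement \<pi>) m"
    and ind: "pi_number \<pi> (group_index G X)"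
    and deg: "\<And>\<chi>. P_pi_character \<pi> G \<chi> \<Longrightarrow> \<exists>d. \<chi> \<one> = of_nat d \<and> pi_number \<pi> d"
  shows "\<exists>H. normal_pi_complement \<pi> H G"
proof -
  interpret A: comm_group "G\<lparr>carrier := N\<rparr>" using el by (simp add: elementary_abelian_def)
  have Ns: "subgroup N G" and Xs: "subgroup X G" using N X by (auto dest: normal_imp_subgroup)
  have ab: "x \<otimes> y = y \<otimes> x" if "x \<in> N" "y \<in> N" for x y using A.m_comm[of x y] that by simp
  have piN: "pi_number \<pi> (card N)" using elementary_abelian_order[OF el p] by (simp add: Coset.order_def)
  have cop: "coprime m (card N)" using pi_number_coprime[OF piN card(2)] by (simp add: coprime_commute)
  obtain H where H: "subgroup H G" "H \<subseteq> X" "card H = m" "N <#> H = X"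
    and frat: "\<And>g. g \<in> carrier G \<Longrightarrow> \<exists>n\<in>N. \<forall>h\<in>H. n \<otimes> (g \<otimes> h \<otimes> inv g) \<otimes> inv n \<in> H"
    using schur_zassenhaus_abelian[OF fin N ab X NX card(1) cop] by blast
  have "H \<lhd> G"
  proof (rule ccontr)
    assume nH: "\<not> H \<lhd> G"
    obtain M where M: "maximal_subgroup M G" "N \<inter> M = {\<one>}" "N <#> M = carrier G"
      using exists_complement_maximal[OF fin N ab min H(1) nH frat] by blast
    interpret split_extension G N M
    proof (intro split_extension.intro split_extension_axioms.intro)
      show "subgroup M G" using M(1) by (simp add: maximal_subgroup_def)
    qed (use M fin N ab is_group in simp_all)
    have cen: "x \<otimes> n = n \<otimes> x" if "x \<in> X" "n \<in> N" for x n
      by (rule centralizes[OF M(1) piN el X NX card _ that]) (erule deg)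
    have "H \<lhd> G"
    proof (subst normal_inv_iff, intro conjI ballI)
      fix g h assume g: "g \<in> carrier G" and h: "h \<in> H"
      have hG: "h \<in> carrier G" using h H(1) subgroup.subset by blast
      obtain n where n: "n \<in> N" "n \<otimes> (g \<otimes> h \<otimes> inv g) \<otimes> inv n \<in> H" using frat[OF g] h by blast
      \<comment> \<open>The conjugate lies in \<open>X\<close>, which centralizes \<open>N\<close>,
        so the correcting conjugation by \<open>n\<close> does nothing.\<close>
      have "g \<otimes> h \<otimes> inv g \<in> X" using normal.inv_op_closed2[OF X g] h H(2) by blast
      from cen[OF this n(1)] have "n \<otimes> (g \<otimes> h \<otimes> inv g) \<otimes> inv n = g \<otimes> h \<otimes> inv g"
        using g hG n(1) by (metis N.mem_carrier inv_closed inv_solve_right m_closed)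
      then show "g \<otimes> h \<otimes> inv g \<in> H" using n(2) by simp
    qed (rule H(1))
    with nH show False by simp
  qed
  moreover have "group_index G H = group_index G X * card N"
  proof -
    have "group_index G H * m = group_index G X * card N * m"
      using group_index_mult[OF fin H(1)] group_index_mult[OF fin Xs] card(1) H(3) by (simp add: mult.assoc)
    then show ?thesis using card(2) by (simp add: pi_number_def)
  qed
  ultimately have "normal_pi_complement \<pi> H G"
    using H(3) card(2) ind piN by (simp add: normal_pi_complement_def pi_number_mult)
  then show ?thesis by blast
qed

section \<open>Passing to quotients\<close>

text \<open>Instantiated with \<open>r_coset G L\<close>. Working with preimages under an abstract
  surjection keeps coset arithmetic out of the correspondence arguments.\<close>

locale finite_epi = group_hom G H h for G :: "('a, 'b) monoid_scheme" (structure)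
    and H :: "('c, 'd) monoid_scheme" (structure) and h +
  assumes fin: "finite (carrier G)" and surj: "h ` carrier G = carrier H"
begin

definition pre :: "'c set \<Rightarrow> 'a set" where
  "pre S = {g \<in> carrier G. h g \<in> S}"

abbreviation ker :: "'a set" where "ker \<equiv> kernel G H h"

lemma finite_H: "finite (carrier H)"
  using fin surj by (metis finite_imageI)

lemma surjD:
  assumes "y \<in> carrier H" obtains g where "g \<in> carrier G" "h g = y"
  using assms unfolding surj[symmetric] by blast

lemma image_pre:
  assumes S: "S \<subseteq> carrier H"
  shows "h ` pre S = S"
proof
  show "h ` pre S \<subseteq> S" by (auto simp: pre_def)
  show "S \<subseteq> h ` pre S"
  proof
    fix y assume y: "y \<in> S"
    then have "y \<in> carrier H" using S by blast
    then obtain g where "g \<in> carrier G" "h g = y" by (rule surjD)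
    with y show "y \<in> h ` pre S" by (auto simp: pre_def)
  qed
qed

lemma pre_subgroup:
  assumes S: "subgroup S H"
  shows "subgroup (pre S) G"
proof (rule G.subgroupI)
  show "pre S \<subseteq> carrier G" by (auto simp: pre_def)
  have "\<one> \<in> pre S" using subgroup.one_closed[OF S] by (simp add: pre_def)
  then show "pre S \<noteq> {}" by blast
next
  fix a assume "a \<in> pre S"
  then show "inv a \<in> pre S" using subgroup.m_inv_closed[OF S] by (simp add: pre_def)
next
  fix a b assume "a \<in> pre S" "b \<in> pre S"
  then show "a \<otimes> b \<in> pre S" using subgroup.m_closed[OF S] by (simp add: pre_def)
qed

lemma pre_normal:
  assumes S: "S \<lhd> H"
  shows "pre S \<lhd> G"
proof (subst G.normal_inv_iff, intro conjI ballI)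
  show "subgroup (pre S) G" using S by (intro pre_subgroup normal_imp_subgroup)
  fix x y assume "x \<in> carrier G" "y \<in> pre S"
  then show "x \<otimes> y \<otimes> inv x \<in> pre S"
    using normal.inv_op_closed2[OF S, of "h x" "h y"] by (simp add: pre_def)
qed

lemma image_normal:
  assumes "S \<lhd> G"
  shows "h ` S \<lhd> H"
  using normal.surj_hom_normal_subgroup[OF assms group_hom_axioms surj] .

lemma ker_subset_pre: "subgroup S H \<Longrightarrow> ker \<subseteq> pre S"
  using subgroup.one_closed by (fastforce simp: pre_def kernel_def)

lemma pre_image:
  assumes S: "subgroup S G" and k: "ker \<subseteq> S"
  shows "pre (h ` S) = S"
proof
  have SG: "S \<subseteq> carrier G" using S by (rule subgroup.subset)
  show "S \<subseteq> pre (h ` S)" using SG by (auto simp: pre_def)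
  show "pre (h ` S) \<subseteq> S"
  proof
    fix g assume "g \<in> pre (h ` S)"
    then obtain s where gs: "g \<in> carrier G" "s \<in> S" "h g = h s" by (auto simp: pre_def)
    have sG: "s \<in> carrier G" using gs SG by blast
    have "h (g \<otimes> inv s) = \<one>\<^bsub>H\<^esub>" using gs sG by simp
    then have "g \<otimes> inv s \<in> S" using k gs sG by (auto simp: kernel_def)
    then have "g \<otimes> inv s \<otimes> s \<in> S" using gs(2) subgroup.m_closed[OF S] by blast
    then show "g \<in> S" using gs(1) sG by (simp add: G.m_assoc)
  qed
qed

text \<open>All fibres are cosets of the kernel. The general semiring covers both cardinalities,
  with constant 1, and sums of character values.\<close>

lemma sum_pre:
  fixes f :: "'c \<Rightarrow> 'e :: comm_semiring_1"
  assumes S: "S \<subseteq> carrier H"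
  shows "(\<Sum>g\<in>pre S. f (h g)) = of_nat (card ker) * (\<Sum>s\<in>S. f s)"
proof -
  have fib: "card {g \<in> pre S. h g = s} = card ker" if s: "s \<in> S" for s
  proof -
    have "s \<in> carrier H" using s S by blast
    then obtain x where x: "x \<in> carrier G" "h x = s" by (rule surjD)
    have "bij_betw (\<lambda>g. x \<otimes> g) ker {g \<in> pre S. h g = s}"
    proof (intro bij_betw_byWitness[of _ "\<lambda>g. inv x \<otimes> g"] ballI subsetI)
      fix g assume "g \<in> ker"
      then show "inv x \<otimes> (x \<otimes> g) = g" using x(1) by (simp add: kernel_def G.group_simps)
    next
      fix g assume "g \<in> {g \<in> pre S. h g = s}"
      then show "x \<otimes> (inv x \<otimes> g) = g" using x(1) by (simp add: pre_def G.group_simps)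
    next
      fix y assume "y \<in> (\<lambda>g. x \<otimes> g) ` ker"
      then show "y \<in> {g \<in> pre S. h g = s}" using x s \<open>s \<in> carrier H\<close> by (auto simp: pre_def kernel_def)
    next
      fix y assume "y \<in> (\<lambda>g. inv x \<otimes> g) ` {g \<in> pre S. h g = s}"
      then show "y \<in> ker" using x \<open>s \<in> carrier H\<close> by (auto simp: pre_def kernel_def)
    qed
    from bij_betw_same_card[OF this] show ?thesis by (rule sym)
  qed
  have "finite (pre S)" using fin by (simp add: pre_def)
  moreover have "finite S" using finite_H S by (rule rev_finite_subset)
  ultimately have "(\<Sum>g\<in>pre S. f (h g)) = (\<Sum>s\<in>S. \<Sum>g\<in>{g \<in> pre S. h g = s}. f (h g))"
    by (intro sum.group[symmetric]) (auto simp: pre_def)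
  also have "\<dots> = (\<Sum>s\<in>S. of_nat (card ker) * f s)" using fib by (intro sum.cong) auto
  finally show ?thesis by (simp add: sum_distrib_left)
qed

lemma card_pre: "S \<subseteq> carrier H \<Longrightarrow> card (pre S) = card ker * card S"
  using sum_pre[of S "\<lambda>_. 1 :: nat"] by simp

lemma card_ker_pos: "card ker > 0"
  by (rule G.card_subgroup_pos[OF fin subgroup_kernel])

lemma group_index_pre:
  assumes S: "subgroup S H"
  shows "group_index G (pre S) = group_index H S"
proof -
  have SH: "S \<subseteq> carrier H" using S by (rule subgroup.subset)
  have "pre (carrier H) = carrier G" by (auto simp: pre_def)
  then have "card (carrier G) = card ker * card (carrier H)" using card_pre[of "carrier H"] by simp
  then have "group_index G (pre S) * (card ker * card S) = group_index H S * (card ker * card S)"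
    using G.group_index_mult[OF fin pre_subgroup[OF S]] H.group_index_mult[OF finite_H S] card_pre[OF SH]
    by (metis mult.left_commute)
  then show ?thesis using card_ker_pos H.card_subgroup_pos[OF finite_H S] by simp
qed

lemma pre_maximal:
  assumes M: "maximal_subgroup M H"
  shows "maximal_subgroup (pre M) G"
  unfolding maximal_subgroup_def
proof (intro conjI allI impI)
  have Ms: "subgroup M H" and MH: "M \<noteq> carrier H"
    and max: "\<And>K. subgroup K H \<Longrightarrow> M \<subseteq> K \<Longrightarrow> K = M \<or> K = carrier H"
    using M by (auto simp: maximal_subgroup_def)
  show "subgroup (pre M) G" using Ms by (rule pre_subgroup)
  have im: "h ` pre M = M" using Ms by (intro image_pre subgroup.subset)
  show "pre M \<noteq> carrier G" using im surj MH by metis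
  fix K assume "subgroup K G \<and> pre M \<subseteq> K"
  then have K: "subgroup K G" "pre M \<subseteq> K" by auto
  have "M \<subseteq> h ` K" using im K(2) by (metis image_mono)
  then have "h ` K = M \<or> h ` K = carrier H" using max[OF subgroup_img_is_subgroup[OF K(1)]] by blast
  moreover have "pre (h ` K) = K" using K ker_subset_pre[OF Ms] by (intro pre_image) auto
  moreover have "pre (carrier H) = carrier G" by (auto simp: pre_def)
  ultimately show "K = pre M \<or> K = carrier G" by metis
qed

lemma lift_irreducible:
  assumes "irreducible_representation H n \<rho>"
  shows "irreducible_representation G n (\<rho> \<circ> h)"
proof -
  have "(\<forall>g\<in>carrier G. \<forall>w\<in>W. (\<rho> \<circ> h) g *\<^sub>v w \<in> W) \<longleftrightarrow> (\<forall>y\<in>carrier H. \<forall>w\<in>W. \<rho> y *\<^sub>v w \<in> W)" for W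
    using surj by (metis (no_types, lifting) comp_apply hom_closed image_iff)
  moreover have "representation G n (\<rho> \<circ> h)"
    using assms Group.hom_compose[OF homh]
    unfolding irreducible_representation_def representation_def by blast
  ultimately show ?thesis using assms unfolding irreducible_representation_def by simp
qed

text \<open>Inflation has the same invariant subspaces, preserves the index of the maximal subgroup
  and multiplies the sum over it by |ker|. The value at the identity is unchanged, so quotients
  inherit the degree hypothesis.\<close>

lemma lift_P_pi_character:
  assumes "P_pi_character \<pi> H \<chi>"
  shows "P_pi_character \<pi> G (\<lambda>g\<in>carrier G. \<chi> (h g))"
proof -
  from assms obtain n \<rho> M where r: "irreducible_representation H n \<rho>" "\<chi> = character H \<rho>"
    and M: "maximal_subgroup M H" "pi_number \<pi> (group_index H M)" "(\<Sum>m\<in>M. \<chi> m) \<noteq> 0"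
    unfolding P_pi_character_iff[OF H.is_group finite_H] Irr_def by blast
  have Ms: "subgroup M H" using M by (simp add: maximal_subgroup_def)
  have eq: "(\<lambda>g\<in>carrier G. \<chi> (h g)) = character G (\<rho> \<circ> h)"
    by (auto simp: r(2) character_def)
  have "(\<Sum>m\<in>pre M. (\<lambda>g\<in>carrier G. \<chi> (h g)) m) = (\<Sum>m\<in>pre M. \<chi> (h m))"
    by (intro sum.cong) (auto simp: pre_def)
  also have "\<dots> \<noteq> 0" using sum_pre[OF subgroup.subset[OF Ms], of \<chi>] M(3) card_ker_pos by simp
  finally have nz: "(\<Sum>m\<in>pre M. (\<lambda>g\<in>carrier G. \<chi> (h g)) m) \<noteq> 0" .
  have "(\<lambda>g\<in>carrier G. \<chi> (h g)) \<in> Irr G"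
    unfolding eq Irr_def using lift_irreducible[OF r(1)] by blast
  moreover have "pi_number \<pi> (group_index G (pre M))" using M(2) by (simp add: group_index_pre[OF Ms])
  ultimately show ?thesis
    unfolding P_pi_character_iff[OF G.is_group fin] using nz pre_maximal[OF M(1)] by blast
qed

end

lemma (in group) finite_epi_Mod:
  assumes "finite (carrier G)" "L \<lhd> G"
  shows "finite_epi G (G Mod L) (r_coset G L)"
proof (intro finite_epi.intro group_hom.intro finite_epi_axioms.intro group_hom_axioms.intro is_group)
  show "group (G Mod L)" using assms(2) by (rule normal.factorgroup_is_group)
  show "r_coset G L \<in> hom G (G Mod L)" using normal.r_coset_hom_Mod[OF assms(2)] by simp
  show "r_coset G L ` carrier G = carrier (G Mod L)" by (simp add: carrier_FactGroup)
qed (rule assms(1))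

lemma (in group) kernel_Mod:
  assumes "L \<lhd> G"
  shows "kernel G (G Mod L) (r_coset G L) = L"
proof -
  have L: "subgroup L G" using assms by (rule normal_imp_subgroup)
  show ?thesis
  proof
    show "kernel G (G Mod L) (r_coset G L) \<subseteq> L"
      using coset_join1[OF _ _ L] by (auto simp: kernel_def)
    show "L \<subseteq> kernel G (G Mod L) (r_coset G L)"
      using subgroup.subset[OF L] coset_join2[OF _ L] by (auto simp: kernel_def)
  qed
qed

section \<open>Induction down a chief series\<close>

lemma (in group) exists_chief_pair:
  assumes fin: "finite (carrier G)" and L: "L \<lhd> G" "L \<noteq> carrier G"
  obtains K where "chief_pair G K L"
proof -
  let ?S = "{K. K \<lhd> G \<and> L \<subset> K}"
  have "?S \<subseteq> Pow (carrier G)"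
    by (metis (no_types, lifting) CollectD PowI normal_imp_subgroup subgroup.subset subsetI)
  then have finS: "finite ?S" using fin by (meson finite_Pow_iff finite_subset)
  have "carrier G \<lhd> G" by (rule normal_self)
  then have "carrier G \<in> ?S" using L normal_imp_subgroup[OF L(1)] subgroup.subset by blast
  from finite_has_minimal2[OF finS this] obtain K where K: "K \<lhd> G" "L \<subset> K"
    and min: "\<forall>N\<in>?S. N \<subseteq> K \<longrightarrow> K = N" by auto
  have "chief_pair G K L" unfolding chief_pair_def
  proof (intro conjI notI K L)
    assume "\<exists>N. N \<lhd> G \<and> L \<subset> N \<and> N \<subset> K"
    then obtain N where "N \<lhd> G" "L \<subset> N" "N \<subset> K" by blast
    with min show False by auto
  qed
  then show thesis by (rule that)
qed

text \<open>The claim is that \<open>X / L\<close> is a normal pi-complement of G/L, phrased inside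
  \<open>G\<close> so that the induction stays in one type. Taking \<open>L\<close> trivial gives
  the complement of \<open>G\<close>.\<close>

lemma (in group) complement_from_degrees:
  assumes fin: "finite (carrier G)" and solv: "pi_solvable \<pi> G"
    and deg: "\<And>\<chi>. P_pi_character \<pi> G \<chi> \<Longrightarrow> \<exists>d. \<chi> \<one> = of_nat d \<and> pi_number \<pi> d"
    and L: "L \<lhd> G"
  shows "\<exists>X m. X \<lhd> G \<and> L \<subseteq> X \<and> card X = card L * m \<and> pi_number (prime_complement \<pi>) m \<and>
    pi_number \<pi> (group_index G X)"
  using L
proof (induction "card (carrier G) - card L" arbitrary: L rule: less_induct)
  case less
  have Ls: "subgroup L G" using less.prems by (rule normal_imp_subgroup)
  show ?case
  proof (cases "L = carrier G")
    case True
    have "group_index G (carrier G) = 1"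
      using group_index_mult[OF fin subgroup_self] card_subgroup_pos[OF fin subgroup_self] by simp
    then show ?thesis using True less.prems by (intro exI[of _ L] exI[of _ 1]) auto
  next
    case False
    obtain K where chief: "chief_pair G K L" using exists_chief_pair[OF fin less.prems False] .
    then have K: "K \<lhd> G" "L \<subset> K" and chmin: "\<And>N. N \<lhd> G \<Longrightarrow> L \<subseteq> N \<Longrightarrow> N \<subseteq> K \<Longrightarrow> N = L \<or> N = K"
      by (auto simp: chief_pair_def)
    have Ks: "subgroup K G" using K(1) by (rule normal_imp_subgroup)
    have KG: "K \<subseteq> carrier G" using Ks by (rule subgroup.subset)
    have "card L < card K" using K(2) fin KG by (meson finite_subset psubset_card_mono)
    moreover have "card K \<le> card (carrier G)" using fin KG by (rule card_mono)
    ultimately have "card (carrier G) - card K < card (carrier G) - card L" by simp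
    from less.hyps[OF this K(1)] obtain X m where X: "X \<lhd> G" "K \<subseteq> X" "card X = card K * m"
      "pi_number (prime_complement \<pi>) m" "pi_number \<pi> (group_index G X)" by blast
    interpret E: finite_epi G "G Mod L" "r_coset G L" using fin less.prems by (rule finite_epi_Mod)
    let ?Q = "G Mod L" and ?N = "r_coset G L ` K"
    have ker: "kernel G ?Q (r_coset G L) = L" using less.prems by (rule kernel_Mod)
    \<comment> \<open>The two structures are literally equal, so properties of the chief factor
      carry over without an isomorphism.\<close>
    have QK: "G\<lparr>carrier := K\<rparr> Mod L = ?Q\<lparr>carrier := ?N\<rparr>"
      by (auto simp: FactGroup_def RCOSETS_def fun_eq_iff)
    have preN: "E.pre ?N = K" using Ks K(2) ker by (intro E.pre_image) auto
    have NQ: "?N \<subseteq> carrier ?Q" using KG by (auto simp: carrier_FactGroup)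
    have cK: "card K = card L * card ?N" using E.card_pre[OF NQ] preN ker by simp
    from solv chief consider
      (a) "pi_group (prime_complement \<pi>) (G\<lparr>carrier := K\<rparr> Mod L)"
      | (b) p where "p \<in> \<pi>" "elementary_abelian p (G\<lparr>carrier := K\<rparr> Mod L)"
      unfolding pi_solvable_def by blast
    then show ?thesis
    proof cases
      \<comment> \<open>The same \<open>X\<close> works for \<open>L\<close>, since |X : L| = |K :
        L| m is still a pi'-number.\<close>
      case a
      then have "pi_number (prime_complement \<pi>) (card ?N)"
        unfolding QK by (simp add: pi_group_def Coset.order_def)
      then show ?thesis using X K(2) cK
        by (intro exI[of _ X] exI[of _ "card ?N * m"]) (auto simp: pi_number_mult)
    next
      case b
      have Xs: "subgroup X G" using X(1) by (rule normal_imp_subgroup)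
      let ?X = "r_coset G L ` X"
      have preX: "E.pre ?X = X" using Xs X(2) K(2) ker by (intro E.pre_image) auto
      have Xn: "?X \<lhd> ?Q" using X(1) by (rule E.image_normal)
      have XQ: "subgroup ?X ?Q" using Xn by (rule normal_imp_subgroup)
      have cX: "card X = card L * card ?X" using E.card_pre[OF subgroup.subset[OF XQ]] preX ker by simp
      have "\<exists>H. normal_pi_complement \<pi> H ?Q"
      proof (rule E.H.complement_step)
        show "finite (carrier ?Q)" by (rule E.finite_H)
        show "?N \<lhd> ?Q" using K(1) by (rule E.image_normal)
        show "elementary_abelian p (?Q\<lparr>carrier := ?N\<rparr>)" using b QK by simp
        show "p \<in> \<pi>" by (rule b)
        show "?X \<lhd> ?Q" by (rule Xn)
        show "?N \<subseteq> ?X" using X(2) by (rule image_mono)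
        show "card ?X = card ?N * m"
          using cX cK X(3) card_subgroup_pos[OF fin Ls] by (simp add: mult.assoc)
        show "pi_number (prime_complement \<pi>) m" by (rule X)
        show "pi_number \<pi> (group_index ?Q ?X)" using X(5) E.group_index_pre[OF XQ] preX by simp
      next
        \<comment> \<open>Minimality of \<open>K / L\<close>: the preimage of \<open>S\<close> lies
          between \<open>L\<close> and \<open>K\<close>, so the chief pair leaves only the two
          ends.\<close>
        fix S assume S: "S \<lhd> ?Q" "S \<subseteq> ?N"
        have Ss: "subgroup S ?Q" using S(1) by (rule normal_imp_subgroup)
        have "L \<subseteq> E.pre S" using E.ker_subset_pre[OF Ss] ker by simp
        moreover have "E.pre S \<subseteq> K" using S(2) preN by (auto simp: E.pre_def)
        ultimately have "E.pre S = L \<or> E.pre S = K" using chmin[OF E.pre_normal[OF S(1)]] by blast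
        moreover have "S = r_coset G L ` E.pre S" using E.image_pre[OF subgroup.subset[OF Ss]] by simp
        moreover have "r_coset G L ` L = {\<one>\<^bsub>?Q\<^esub>}"
        proof -
          have "r_coset G L x = L" if "x \<in> L" for x
            using coset_join2[OF _ Ls that] that subgroup.subset[OF Ls] by blast
          then show ?thesis using subgroup.one_closed[OF Ls] by auto
        qed
        ultimately show "S = {\<one>\<^bsub>?Q\<^esub>} \<or> S = ?N" by metis
      next
        fix \<chi> assume "P_pi_character \<pi> ?Q \<chi>"
        from deg[OF E.lift_P_pi_character[OF this]]
        show "\<exists>d. \<chi> \<one>\<^bsub>?Q\<^esub> = of_nat d \<and> pi_number \<pi> d"
          using subgroup.subset[OF Ls] by simp
      qed
      then obtain S where S: "S \<lhd> ?Q" "pi_number (prime_complement \<pi>) (card S)" "pi_number \<pi> (group_index ?Q S)"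
        by (auto simp: normal_pi_complement_def)
      have Ss: "subgroup S ?Q" using S(1) by (rule normal_imp_subgroup)
      show ?thesis
      proof (intro exI conjI)
        show "E.pre S \<lhd> G" using S(1) by (rule E.pre_normal)
        show "L \<subseteq> E.pre S" using E.ker_subset_pre[OF Ss] ker by simp
        show "card (E.pre S) = card L * card S" using E.card_pre[OF subgroup.subset[OF Ss]] ker by simp
        show "pi_number (prime_complement \<pi>) (card S)" by (rule S)
        show "pi_number \<pi> (group_index G (E.pre S))" using S(3) by (simp add: E.group_index_pre[OF Ss])
      qed
    qed
  qed
qed

section \<open>Degrees in the presence of a normal complement\<close>

lemma (in group) degree_from_complement:
  assumes fin: "finite (carrier G)" and H: "normal_pi_complement \<pi> H G" and P: "P_pi_character \<pi> G \<chi>"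
  shows "\<exists>d. \<chi> \<one> = of_nat d \<and> pi_number \<pi> d"
proof -
  have Hn: "H \<lhd> G" and piH: "pi_number (prime_complement \<pi>) (card H)" and ind: "pi_number \<pi> (group_index G H)"
    using H by (auto simp: normal_pi_complement_def)
  from P obtain n \<rho> M where r: "irreducible_representation G n \<rho>" "\<chi> = character G \<rho>"
    and M: "maximal_subgroup M G" "pi_number \<pi> (group_index G M)" "(\<Sum>m\<in>M. \<chi> m) \<noteq> 0"
    unfolding P_pi_character_iff[OF is_group fin] Irr_def by blast
  interpret irreducible_rep G n \<rho> using fin r(1) by unfold_locales
  have Ms: "subgroup M G" using M by (simp add: maximal_subgroup_def)
  \<comment> \<open>The coprime index argument with the trivial subgroup as \<open>B\<close> and |H|
    as \<open>m\<close>.\<close>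
  have "H \<subseteq> M"
    using normal_subset_of_index[OF fin Hn Ms triv_subgroup _ _ _ piH M(2)]
      subgroup.one_closed[OF Ms] subgroup.one_closed[OF normal_imp_subgroup[OF Hn]] by simp
  then have ker: "\<rho> x = 1\<^sub>m n" if "x \<in> H" for x
    using kernel_contains_normal[OF Ms Hn] M(3) r(2) that by blast
  interpret E: finite_epi G "G Mod H" "r_coset G H" using fin Hn by (rule finite_epi_Mod)
  have "\<rho> x = \<rho> y" if xy: "x \<in> carrier G" "y \<in> carrier G" "H #> x = H #> y" for x y
  proof -
    have "x \<in> H #> y" using rcos_self[OF xy(1) normal_imp_subgroup[OF Hn]] xy(3) by simp
    then obtain k where k: "k \<in> H" "x = k \<otimes> y" by (auto simp: r_coset_def)
    have "k \<in> carrier G" using k(1) normal_imp_subgroup[OF Hn] subgroup.subset by blast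
    then show ?thesis using k ker rho_mult[of k y] xy rho_carrier[of y] by simp
  qed
  moreover have "\<rho> \<in> hom G (units_of (ring_mat TYPE(complex) n ()))"
    using rep by (simp add: representation_def)
  ultimately obtain \<sigma> where \<sigma>: "\<sigma> \<in> hom (G Mod H) (units_of (ring_mat TYPE(complex) n ()))"
    "\<And>x. x \<in> carrier G \<Longrightarrow> \<sigma> (H #> x) = \<rho> x"
    using FactGroup_universal[OF _ Hn] by blast
  \<comment> \<open>The factored map has the same image operators, hence the same invariant
    subspaces, and stays irreducible; its degree therefore divides |G : H|.\<close>
  have "(\<forall>g\<in>carrier G. \<forall>w\<in>W. \<rho> g *\<^sub>v w \<in> W) \<longleftrightarrow> (\<forall>y\<in>carrier (G Mod H). \<forall>w\<in>W. \<sigma> y *\<^sub>v w \<in> W)" for W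
    using \<sigma>(2) by (auto simp: carrier_FactGroup)
  then have "irreducible_representation (G Mod H) n \<sigma>"
    using r(1) \<sigma>(1) unfolding irreducible_representation_def representation_def by simp
  then interpret Q: irreducible_rep "G Mod H" n \<sigma>
    using E.finite_H by unfold_locales
  have "n dvd group_index G H"
    using Q.degree_dvd_order by (simp add: group_index_def FactGroup_def)
  then have "pi_number \<pi> n" using ind by (rule pi_number_dvd[rotated])
  then show ?thesis using character_one r(2) by blast
qed

theorem theorem3:
  fixes \<pi> :: "nat set" and G :: "('a, 'b) monoid_scheme"
  assumes "\<And>p. p \<in> \<pi> \<Longrightarrow> prime p"
    and "group G" and "finite (carrier G)"
    and "pi_solvable \<pi> G"
  shows "(\<forall>\<chi>. P_pi_character \<pi> G \<chi> \<longrightarrow> (\<exists>d. \<chi> \<one>\<^bsub>G\<^esub> = of_nat d \<and> pi_number \<pi> d))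
     \<longleftrightarrow> (\<exists>H. normal_pi_complement \<pi> H G)"
proof -
  interpret group G by fact
  note fin = assms(3)
  show ?thesis
  proof
    assume deg: "\<forall>\<chi>. P_pi_character \<pi> G \<chi> \<longrightarrow> (\<exists>d. \<chi> \<one>\<^bsub>G\<^esub> = of_nat d \<and> pi_number \<pi> d)"
    \<comment> \<open>For trivial \<open>L\<close> the number \<open>m\<close> is the order of
      \<open>X\<close>.\<close>
    obtain X m where "X \<lhd> G" "card X = card {\<one>\<^bsub>G\<^esub>} * m" "pi_number (prime_complement \<pi>) m"
      "pi_number \<pi> (group_index G X)"
      using complement_from_degrees[OF fin assms(4) _ one_is_normal] deg by blast
    then show "\<exists>H. normal_pi_complement \<pi> H G" by (auto simp: normal_pi_complement_def)
  qed (use degree_from_complement[OF fin] in blast)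
qed

end
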